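(* Let $t > 0$ be an integer and let $\varepsilon > 0$. Then there exists $n_0$ such that the following holds for all $n \ge n_0$. If $G$ is a graph on $n$ vertices equipped with a proper edge coloring and the average degree of $G$ is at least $(\log n)^{2+\varepsilon}$, then $G$ contains a rainbow subdivision of the complete graph $K_t$, i.e. a subgraph which is a $\mathsf{T}K_t$ all of whose edges have pairwise distinct colors.
   Context: All logarithms are base $2$. A subdivision $\mathsf{T}K_t$ of $K_t$ is a graph obtained from $K_t$ by replacing each edge by a path, these paths being internally vertex-disjoint. A proper edge coloring assigns colors to edges so that edges sharing a vertex get different colors. A subgraph is rainbow if all its edges have distinct colors. The paper states the hypothesis as "average degree at least $(\log n)^{2+o(1)}$"; this is made precise above as: for every fixed $\varepsilon>0$ and all sufficiently large $n$, average degree at least $(\log n)^{2+\varepsilon}$ suffices. *)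

theory Defs
  imports Complex_Main "Graph_Theory.Graph_Theory"
begin

text \<open>
  A finite simple graph is a \<^locale>\<open>pair_graph\<close>: a finite, loopless, symmetric digraph whose arcs
  are pairs of vertices. Each undirected edge $\{u,v\}$ is represented by the two arcs $(u,v)$
  and $(v,u)$; edge colorings are functions on the two-element sets $\{u,v\}$.
\<close>

definition uedges :: "'a pair_pre_digraph \<Rightarrow> 'a set set" where
  "uedges G = {{u, v} | u v. (u, v) \<in> parcs G}"

text \<open>In a \<^locale>\<open>pair_graph\<close>, \<^const>\<open>out_degree\<close> is the number of neighbours of a vertex.\<close>

definition average_degree :: "'a pair_pre_digraph \<Rightarrow> real" where
  "average_degree G =
     (\<Sum>v\<in>pverts G. real (out_degree (with_proj G) v)) / real (card (pverts G))"

definition proper_edge_coloring :: "'a pair_pre_digraph \<Rightarrow> ('a set \<Rightarrow> 'c) \<Rightarrow> bool" where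
  "proper_edge_coloring G col \<longleftrightarrow>
     (\<forall>e\<in>uedges G. \<forall>f\<in>uedges G. e \<noteq> f \<and> e \<inter> f \<noteq> {} \<longrightarrow> col e \<noteq> col f)"

definition rainbow :: "('a set \<Rightarrow> 'c) \<Rightarrow> 'a pair_pre_digraph \<Rightarrow> bool" where
  "rainbow col H \<longleftrightarrow> inj_on col (uedges H)"

text \<open>
  \<^const>\<open>subdivision\<close> iterates the replacement of an edge $uv$ by a path $u,w,v$ through a new
  vertex $w$; this amounts to replacing every edge by a path (possibly of length one), with the
  paths pairwise internally disjoint.
\<close>

definition is_clique_subdivision :: "nat \<Rightarrow> 'a pair_pre_digraph \<Rightarrow> bool" where
  "is_clique_subdivision t H \<longleftrightarrow>
     (\<exists>K. complete_digraph t (with_proj K) \<and> subdivision_pair K H)"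

end

theory Submission
  imports Defs "HOL-Library.Disjoint_Sets" "HOL-Real_Asymp.Real_Asymp"
begin

text \<open>
  Let $L = \log_2 n$ and pass to a vertex set $A$ maximising $e(A)/|A|^{1+1/L}$; the average degree
  drops by a factor of at most 2. Extremality shows that a set $B$ of at most half of the vertices
  expands: even after discarding $o(|B| \cdot d/L)$ of its arcs, its neighbourhood grows it by the
  factor $1 + \gamma$, where $\gamma$ is of order $\log(|A|/|B|)/L$.

  Fix a vertex $v$ together with few forbidden vertices and colours, and let $B$ be the set of
  vertices reached so far from $v$ by short rainbow walks, one walk being designated for each of
  them. An arc at $b \in B$ is unusable only if it meets a forbidden vertex or colour or a colour of
  the designated walk of $b$. There are many bundles of $k$ differently coloured usable arcs such
  that hitting different bundles yields different new vertices, so revealing a sparse random set of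
  colours enlarges $B$ by the factor $1 + \gamma/2$ with high probability. After $O(L \log L)$ rounds,
  $v$ reaches more than half of $A$ within a random half of the colours. Reaching from $w$ in the
  complementary half gives a rainbow path from $v$ to $w$. Its length is small compared with $d/L$,
  so arbitrary $t$ branch vertices can be joined greedily, each time forbidding all vertices and
  colours used before.
\<close>

section \<open>Random sets of colours\<close>

text \<open>The expectation of \<open>f A\<close> when \<open>A\<close> contains each element of
  \<open>K\<close> independently with probability \<open>p\<close>. Written as a finite weighted
  sum, it is accessible to induction on \<open>K\<close>.\<close>

definition rset_mean :: "'c set \<Rightarrow> real \<Rightarrow> ('c set \<Rightarrow> real) \<Rightarrow> real" where
  "rset_mean K p f = (\<Sum>A\<in>Pow K. p ^ card A * (1 - p) ^ card (K - A) * f A)"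

lemma rset_mean_insert:
  assumes "finite K" "x \<notin> K"
  shows "rset_mean (insert x K) p f =
           p * rset_mean K p (\<lambda>A. f (insert x A)) + (1 - p) * rset_mean K p f"
proof -
  let ?w = "\<lambda>A. p ^ card A * (1 - p) ^ card (insert x K - A) * f A"
  have fin: "finite A" if "A \<subseteq> K" for A
    using assms(1) that by (rule rev_finite_subset)
  have disj: "Pow K \<inter> insert x ` Pow K = {}"
    using assms(2) by auto
  have inj: "inj_on (insert x) (Pow K)"
    using assms(2) by (auto simp: inj_on_def)
  have in_w: "?w (insert x A) = p * (p ^ card A * (1 - p) ^ card (K - A) * f (insert x A))"
    if "A \<in> Pow K" for A
  proof -
    have "x \<notin> A" using that assms(2) by auto
    moreover have "insert x K - insert x A = K - A" using assms(2) by auto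
    ultimately show ?thesis using fin[of A] that by simp
  qed
  have out_w: "?w A = (1 - p) * (p ^ card A * (1 - p) ^ card (K - A) * f A)"
    if "A \<in> Pow K" for A
  proof -
    have "insert x K - A = insert x (K - A)" using that assms(2) by auto
    then show ?thesis using assms by simp
  qed
  have "rset_mean (insert x K) p f = sum ?w (Pow K) + sum ?w (insert x ` Pow K)"
    unfolding rset_mean_def Pow_insert using assms(1) disj by (intro sum.union_disjoint) auto
  also have "sum ?w (Pow K) = (1 - p) * rset_mean K p f"
    unfolding rset_mean_def sum_distrib_left by (rule sum.cong[OF refl out_w])
  also have "sum ?w (insert x ` Pow K) = (\<Sum>A\<in>Pow K. ?w (insert x A))"
    using inj by (simp add: sum.reindex)
  also have "\<dots> = p * rset_mean K p (\<lambda>A. f (insert x A))"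
    unfolding rset_mean_def sum_distrib_left by (rule sum.cong[OF refl in_w])
  finally show ?thesis
    by simp
qed

lemma rset_mean_empty [simp]: "rset_mean {} p f = f {}"
  by (simp add: rset_mean_def)

lemma rset_mean_const:
  assumes "finite K"
  shows "rset_mean K p (\<lambda>_. c) = c"
  using assms by (induction K) (simp_all add: rset_mean_insert algebra_simps)

lemma rset_mean_mono:
  assumes "0 \<le> p" "p \<le> 1" "\<And>A. A \<subseteq> K \<Longrightarrow> f A \<le> g A"
  shows "rset_mean K p f \<le> rset_mean K p g"
  unfolding rset_mean_def using assms by (intro sum_mono mult_left_mono) auto

lemma rset_mean_cong:
  assumes "\<And>A. A \<subseteq> K \<Longrightarrow> f A = g A"
  shows "rset_mean K p f = rset_mean K p g"
  unfolding rset_mean_def using assms by (intro sum.cong) auto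

lemma rset_mean_add: "rset_mean K p (\<lambda>A. f A + g A) = rset_mean K p f + rset_mean K p g"
  unfolding rset_mean_def by (simp add: algebra_simps sum.distrib)

lemma rset_mean_cmult: "rset_mean K p (\<lambda>A. c * f A) = c * rset_mean K p f"
  unfolding rset_mean_def sum_distrib_left by (intro sum.cong) auto

lemma rset_mean_sum:
  "rset_mean K p (\<lambda>A. \<Sum>j\<in>J. f j A) = (\<Sum>j\<in>J. rset_mean K p (f j))"
  unfolding rset_mean_def sum_distrib_left by (rule sum.swap)

text \<open>An element lies in neither of two independent random sets with probability
  \<open>(1 - p) * (1 - q)\<close>, so their union is again a random set of this kind. This allows
  colours to be revealed in rounds.\<close>

lemma rset_mean_union:
  assumes "finite K"
  shows "rset_mean K p (\<lambda>A. rset_mean K q (\<lambda>B. f (A \<union> B))) = rset_mean K (p + q - p * q) f"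
  using assms
proof (induction K arbitrary: f)
  case (insert x K)
  note [simp] = rset_mean_insert[OF insert.hyps] rset_mean_add rset_mean_cmult
  have a: "rset_mean K p (\<lambda>A. rset_mean K q (\<lambda>B. f (insert x (A \<union> B))))
     = rset_mean K (p + q - p * q) (\<lambda>A. f (insert x A))"
    by (rule insert.IH)
  show ?case
    by (simp add: a insert.IH) (simp add: algebra_simps)
qed simp

lemma rset_mean_disjoint:
  assumes "finite K" "T \<subseteq> K"
  shows "rset_mean K p (\<lambda>A. of_bool (T \<inter> A = {})) = (1 - p) ^ card T"
  using assms
proof (induction K arbitrary: T)
  case (insert x K)
  show ?case
  proof (cases "x \<in> T")
    case True
    define T' where "T' = T - {x}"
    have T: "T = insert x T'" "x \<notin> T'" "T' \<subseteq> K" "finite T'"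
      using True insert.prems insert.hyps unfolding T'_def by (auto intro: finite_subset)
    have "rset_mean K p (\<lambda>A. of_bool (T \<inter> A = {})) = rset_mean K p (\<lambda>A. of_bool (T' \<inter> A = {}))"
      using insert.hyps T(1) by (intro rset_mean_cong) auto
    then show ?thesis
      using T insert by (simp add: rset_mean_insert rset_mean_const)
  next
    case False
    then have "T \<subseteq> K" using insert.prems by auto
    then show ?thesis
      using False insert by (simp add: rset_mean_insert algebra_simps)
  qed
qed simp

text \<open>At probability 1/2 all subsets of \<open>K\<close> have the same weight, and
  complementation permutes them. So a random half and its complement, though dependent, have the
  same distribution.\<close>

lemma rset_mean_half_compl:
  assumes "finite K"
  shows "rset_mean K (1/2) (\<lambda>A. f (K - A)) = rset_mean K (1/2) f"
proof -
  have fin: "finite A" if "A \<subseteq> K" for A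
    using assms that by (rule rev_finite_subset)
  have w: "(1/2) ^ card A * (1 - 1/2) ^ card (K - A) = (1/2 :: real) ^ card K" if "A \<subseteq> K" for A
    using card_Diff_subset[OF fin that] card_mono[OF assms that] that
    by (simp flip: power_add)
  have "bij_betw (\<lambda>A. K - A) (Pow K) (Pow K)"
    by (rule bij_betw_byWitness[where f' = "\<lambda>A. K - A"]) auto
  then have "(\<Sum>A\<in>Pow K. (1/2) ^ card K * f (K - A)) = (\<Sum>A\<in>Pow K. (1/2) ^ card K * f A)"
    by (rule sum.reindex_bij_betw)
  then show ?thesis
    unfolding rset_mean_def using w by simp
qed

text \<open>The union bound; it requires no independence of the two events.\<close>

lemma rset_mean_avoid:
  assumes "finite K" "0 \<le> p" "p \<le> 1"
    and "rset_mean K p (\<lambda>A. of_bool (P A)) + rset_mean K p (\<lambda>A. of_bool (Q A)) < 1"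
  obtains A where "A \<subseteq> K" "\<not> P A" "\<not> Q A"
proof (rule ccontr)
  assume "\<not> thesis"
  with that have all: "P A \<or> Q A" if "A \<subseteq> K" for A
    using \<open>A \<subseteq> K\<close> by blast
  have "1 = rset_mean K p (\<lambda>_. 1)"
    using assms(1) by (simp add: rset_mean_const)
  also have "\<dots> \<le> rset_mean K p (\<lambda>A. of_bool (P A) + of_bool (Q A))"
    using assms(2,3) all by (intro rset_mean_mono) auto
  finally show False
    using assms(4) by (simp add: rset_mean_add)
qed

text \<open>Markov's inequality for the number of missed bundles: each is missed with probability at
  most \<open>(1 - p) ^ k\<close>, and the threshold of one half costs the factor 2. The bundles may
  overlap.\<close>

lemma rset_mean_few_hits:
  assumes "finite K" "0 \<le> p" "p \<le> 1" "finite J"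
    and "\<And>j. j \<in> J \<Longrightarrow> T j \<subseteq> K \<and> k \<le> card (T j)"
  shows "rset_mean K p (\<lambda>C. of_bool (2 * card {j \<in> J. T j \<inter> C \<noteq> {}} < card J)) \<le> 2 * (1 - p) ^ k"
proof (cases "J = {}")
  case True
  then show ?thesis using assms by (simp add: rset_mean_const)
next
  case False
  then have J: "0 < real (card J)" using assms(4) by (simp add: card_gt_0_iff)
  have "of_bool (2 * card {j \<in> J. T j \<inter> C \<noteq> {}} < card J)
      \<le> 2 / card J * (\<Sum>j\<in>J. of_bool (T j \<inter> C = {}))" for C
  proof -
    have "card J = card {j \<in> J. T j \<inter> C \<noteq> {}} + card {j \<in> J. T j \<inter> C = {}}"
      using assms(4) by (subst card_Un_disjoint[symmetric]) (auto intro: arg_cong[where f = card])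
    moreover have "(\<Sum>j\<in>J. of_bool (T j \<inter> C = {})) = real (card {j \<in> J. T j \<inter> C = {}})"
      using assms(4) by (simp add: Int_def)
    ultimately show ?thesis
      using J by (auto simp: field_simps)
  qed
  then have "rset_mean K p (\<lambda>C. of_bool (2 * card {j \<in> J. T j \<inter> C \<noteq> {}} < card J))
     \<le> rset_mean K p (\<lambda>C. 2 / card J * (\<Sum>j\<in>J. of_bool (T j \<inter> C = {})))"
    using assms(2,3) by (intro rset_mean_mono)
  also have "\<dots> = 2 / card J * (\<Sum>j\<in>J. (1 - p) ^ card (T j))"
    unfolding rset_mean_cmult rset_mean_sum using assms(1,5) by (simp add: rset_mean_disjoint)
  also have "\<dots> \<le> 2 / card J * (\<Sum>j\<in>J. (1 - p) ^ k)"
    using assms J by (intro mult_left_mono sum_mono power_decreasing) auto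
  also have "\<dots> = 2 * (1 - p) ^ k"
    using J by simp
  finally show ?thesis .
qed

section \<open>Expansion of extremal vertex sets\<close>

text \<open>Arcs are ordered pairs, so for symmetric loopless \<open>E\<close> each edge counts
  twice and \<open>arcs_in E A / card A\<close> is the average degree inside
  \<open>A\<close>.\<close>

definition arcs_in :: "('a \<times> 'a) set \<Rightarrow> 'a set \<Rightarrow> real" where
  "arcs_in E A = real (card (E \<inter> A \<times> A))"

lemma arcs_in_nonneg: "0 \<le> arcs_in E A"
  by (simp add: arcs_in_def)

text \<open>For finite nonempty \<open>A\<close>, this says that
  \<open>arcs_in E B / card B powr (1 + \<alpha>)\<close> is maximal at \<open>B = A\<close> among
  the nonempty subsets of \<open>A\<close>.\<close>

definition extremal :: "('a \<times> 'a) set \<Rightarrow> real \<Rightarrow> 'a set \<Rightarrow> bool" where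
  "extremal E \<alpha> A \<longleftrightarrow>
     (\<forall>B. B \<subseteq> A \<and> B \<noteq> {} \<longrightarrow> arcs_in E B \<le> arcs_in E A * (card B / card A) powr (1 + \<alpha>))"

text \<open>A maximiser of the ratio over all nonempty subsets of \<open>V\<close> works: comparison
  with its own subsets gives extremality, comparison with \<open>V\<close> bounds the loss of
  density.\<close>

lemma ex_extremal:
  assumes "finite V" "V \<noteq> {}"
  obtains A where "A \<subseteq> V" "A \<noteq> {}" "extremal E \<alpha> A"
    "arcs_in E V * (card A / card V) powr (1 + \<alpha>) \<le> arcs_in E A"
proof -
  let ?\<phi> = "\<lambda>A. arcs_in E A / card A powr (1 + \<alpha>)"
  have fin: "finite (?\<phi> ` (Pow V - {{}}))" and "V \<in> Pow V - {{}}"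
    using assms by auto
  then have ne: "?\<phi> ` (Pow V - {{}}) \<noteq> {}" by blast
  obtain A where "A \<in> Pow V - {{}}" and A3: "Max (?\<phi> ` (Pow V - {{}})) = ?\<phi> A"
    using Max_in[OF fin ne] by (rule imageE)
  then have A: "A \<subseteq> V" "A \<noteq> {}" by auto
  have max: "?\<phi> B \<le> ?\<phi> A" if "B \<subseteq> V" "B \<noteq> {}" for B
    unfolding A3[symmetric] using fin that by (intro Max_ge) auto
  have pos: "0 < real (card B)" if "B \<subseteq> V" "B \<noteq> {}" for B
    using assms(1) that by (simp add: card_gt_0_iff finite_subset)
  have le: "arcs_in E B * (card A / card B) powr (1 + \<alpha>) \<le> arcs_in E A"
    if "B \<subseteq> V" "B \<noteq> {}" for B
    using max[OF that] pos[OF that] pos[OF A(1,2)]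
    by (simp add: powr_divide divide_simps mult.commute split: if_splits)
  show ?thesis
  proof (rule that)
    show "extremal E \<alpha> A"
      unfolding extremal_def
    proof (intro allI impI)
      fix B assume B': "B \<subseteq> A \<and> B \<noteq> {}"
      then have B: "B \<subseteq> A" "B \<noteq> {}" by auto
      then have "B \<subseteq> V" using A(1) by auto
      from max[OF this B(2)] pos[OF this B(2)] pos[OF A(1,2)]
      show "arcs_in E B \<le> arcs_in E A * (card B / card A) powr (1 + \<alpha>)"
        by (simp add: powr_divide divide_simps mult.commute split: if_splits)
    qed
  qed (use A le[OF order_refl assms(2)] in auto)
qed

lemma exp_minus_le:
  assumes "0 \<le> u" "u \<le> 1"
  shows "exp (- u) \<le> 1 - u / (2 :: real)"
proof -
  have "1 \<le> (1 + u) * (1 - u / 2)"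
    using assms mult_right_mono[of u 1 u] by (simp add: algebra_simps)
  also have "\<dots> \<le> exp u * (1 - u / 2)"
    using assms by (intro mult_right_mono exp_ge_add_one_self) auto
  finally show ?thesis
    by (simp add: exp_minus field_simps)
qed

text \<open>One factor 1/2 comes from \<open>exp_minus_le\<close>, the other from
  \<open>ln 2 \<ge> 1/2\<close>.\<close>

lemma half_powr_le:
  assumes "0 \<le> z" "z \<le> 1"
  shows "2 powr (- z) \<le> 1 - z / (4 :: real)"
proof -
  have "z * ln 2 \<le> z * (1 :: real)"
    using assms ln_le_minus_one[of 2] by (intro mult_left_mono) auto
  then have "exp (- (z * ln 2)) \<le> 1 - z * ln 2 / 2"
    using assms by (intro exp_minus_le) auto
  moreover have "z * (1/2) \<le> z * ln 2"
    using assms ln_le_minus_one[of "1/2"] by (intro mult_left_mono) (auto simp: ln_div)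
  ultimately show ?thesis
    by (simp add: powr_def)
qed

text \<open>
  The proportion by which a set of \<open>b\<close> among \<open>N\<close> vertices expands; the constant 24 makes
  \<open>x powr (1 / L) \<le> 1 - 6 * growth\<close> for \<open>x = b / N\<close>, twice what vertex expansion by the factor
  \<open>1 + growth\<close> can consume.
\<close>

definition growth :: "real \<Rightarrow> nat \<Rightarrow> nat \<Rightarrow> real" where
  "growth L N b = log 2 (real N / real b) / (24 * L)"

text \<open>Deleting \<open>B\<close> destroys at least its proportional share of the arcs, while a
  set only slightly larger than \<open>B\<close> spans noticeably less than this share. By
  \<open>boundary_le\<close> the difference must come from arcs between \<open>B\<close> and the
  vertices outside \<open>B\<close> and \<open>W\<close>.\<close>

lemma extremal_expansion:
  assumes "finite A" "B \<subseteq> A" "B \<noteq> {}" "2 * card B \<le> card A"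
    and L: "1 \<le> L" "log 2 (card A) \<le> L" and ext: "extremal E (1 / L) A"
    and W: "W \<subseteq> A" "card W \<le> growth L (card A) (card B) * card B"
  shows "3 * growth L (card A) (card B) * (arcs_in E A / card A) * card B
    \<le> arcs_in E A - arcs_in E (A - B) - arcs_in E (B \<union> W)"
proof -
  define N where "N = real (card A)"
  define b where "b = real (card B)"
  define x where "x = b / N"
  define y where "y = log 2 (N / b)"
  define \<gamma> where "\<gamma> = growth L (card A) (card B)"
  have fB: "finite B" "finite W" using assms by (auto intro: finite_subset)
  have b: "1 \<le> b" "2 * b \<le> N"
    using assms fB by (auto simp: b_def N_def Suc_le_eq card_gt_0_iff simp flip: of_nat_mult)
  have x: "0 < x" "x \<le> 1" using b by (auto simp: x_def field_simps)
  have \<gamma>: "\<gamma> = y / (24 * L)" by (simp add: \<gamma>_def growth_def y_def N_def b_def)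
  have y0: "0 \<le> y" using b by (simp add: y_def)
  have "N / b \<le> N" using b by (simp add: field_simps)
  then have "y \<le> log 2 N" using b by (simp add: y_def)
  then have yL: "y \<le> L" using L(2) by (simp add: N_def)
  have \<gamma>01: "0 \<le> \<gamma>" "24 * \<gamma> \<le> 1" using y0 yL L by (auto simp: \<gamma> field_simps)
  \<comment> \<open>The exponent may be weakened to 1 here; the whole gain comes from the small set
    \<open>B \<union> W\<close>.\<close>
  have a: "arcs_in E (A - B) \<le> arcs_in E A * (1 - x)"
  proof -
    have cAB: "real (card (A - B)) = N - b"
      using assms fB card_mono[OF assms(1,2)] by (simp add: card_Diff_subset N_def b_def)
    have "A - B \<noteq> {}" using cAB b by (intro notI) simp
    then have "arcs_in E (A - B) \<le> arcs_in E A * (card (A - B) / card A) powr (1 + 1 / L)"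
      using ext by (auto simp: extremal_def)
    also have "card (A - B) / card A = 1 - x"
      using cAB b by (simp add: N_def[symmetric] x_def diff_divide_distrib)
    also have "(1 - x) powr (1 + 1 / L) \<le> (1 - x) powr 1"
      using x L by (intro powr_mono') auto
    finally show ?thesis
      using x arcs_in_nonneg[of E A] by (simp add: mult_left_mono)
  qed
  \<comment> \<open>The gain \<open>x powr (1 / L) \<le> 1 - 6 * \<gamma>\<close> outweighs the loss
    \<open>(1 + \<gamma>) powr 2 \<le> 1 + 3 * \<gamma>\<close> and leaves
    \<open>1 - 3 * \<gamma>\<close>.\<close>
  have e: "arcs_in E (B \<union> W) \<le> arcs_in E A * (x * (1 - 3 * \<gamma>))"
  proof -
    have "real (card (B \<union> W)) \<le> (1 + \<gamma>) * b"
      using card_Un_le[of B W] W(2) by (simp add: algebra_simps b_def \<gamma>_def)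
    then have "card (B \<union> W) / card A \<le> (1 + \<gamma>) * x"
      using b by (simp add: x_def N_def[symmetric] divide_right_mono)
    then have "(card (B \<union> W) / card A) powr (1 + 1 / L) \<le> ((1 + \<gamma>) * x) powr (1 + 1 / L)"
      using L by (intro powr_mono2) auto
    also have "\<dots> = (1 + \<gamma>) powr (1 + 1 / L) * (x * x powr (1 / L))"
      using x \<gamma>01 by (simp add: powr_mult powr_add)
    also have "(1 + \<gamma>) powr (1 + 1 / L) \<le> (1 + \<gamma>) powr 2"
      using L \<gamma>01 by (intro powr_mono) (auto simp: field_simps)
    also have "\<dots> \<le> 1 + 3 * \<gamma>"
      using \<gamma>01 mult_right_mono[of \<gamma> 1 \<gamma>] by (simp add: power2_eq_square algebra_simps)
    also have "x powr (1 / L) = 2 powr (- (24 * \<gamma>))"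
    proof -
      have "ln x = - (y * ln 2)"
        using b by (simp add: x_def y_def log_def ln_div)
      then show ?thesis
        using x L by (simp add: powr_def \<gamma> field_simps)
    qed
    also have "2 powr (- (24 * \<gamma>)) \<le> 1 - 24 * \<gamma> / 4"
      using \<gamma>01 by (intro half_powr_le) auto
    finally have "(card (B \<union> W) / card A) powr (1 + 1 / L) \<le> (1 + 3 * \<gamma>) * (x * (1 - 6 * \<gamma>))"
      using x \<gamma>01 by (simp add: mult_left_mono mult_right_mono)
    also have "\<dots> = x * ((1 + 3 * \<gamma>) * (1 - 6 * \<gamma>))" by simp
    also have "\<dots> \<le> x * (1 - 3 * \<gamma>)"
      using x \<gamma>01 by (intro mult_left_mono) (auto simp: algebra_simps)
    finally have *: "(card (B \<union> W) / card A) powr (1 + 1 / L) \<le> x * (1 - 3 * \<gamma>)" .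
    have "arcs_in E (B \<union> W) \<le> arcs_in E A * (card (B \<union> W) / card A) powr (1 + 1 / L)"
      using ext assms by (auto simp: extremal_def)
    also have "\<dots> \<le> arcs_in E A * (x * (1 - 3 * \<gamma>))"
      by (intro mult_left_mono * arcs_in_nonneg)
    finally show ?thesis .
  qed
  have "3 * \<gamma> * (arcs_in E A / N) * b = arcs_in E A * (3 * \<gamma> * x)"
    by (simp add: x_def)
  also have "\<dots> = arcs_in E A - arcs_in E A * (1 - x) - arcs_in E A * (x * (1 - 3 * \<gamma>))"
    by (simp add: algebra_simps)
  also have "\<dots> \<le> arcs_in E A - arcs_in E (A - B) - arcs_in E (B \<union> W)"
    using a e by linarith
  finally show ?thesis by (simp add: \<gamma>_def N_def b_def)
qed

text \<open>Every arc of \<open>A\<close> lies inside \<open>A - B\<close>, lies inside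
  \<open>B \<union> W\<close>, or joins \<open>B\<close> to \<open>A - B - W\<close>; the factor 2
  covers the two orientations of the last kind.\<close>

lemma boundary_le:
  assumes "finite A" "B \<subseteq> A" "W \<subseteq> A" "sym E"
  shows "arcs_in E A - arcs_in E (A - B) - arcs_in E (B \<union> W)
    \<le> 2 * real (card (E \<inter> B \<times> (A - B - W)))"
proof -
  let ?X = "E \<inter> B \<times> (A - B - W)"
  have fin: "finite ?X" "finite (E \<inter> (A - B) \<times> (A - B))" "finite (E \<inter> (B \<union> W) \<times> (B \<union> W))"
    using assms by (auto intro: finite_subset)
  have sub: "E \<inter> A \<times> A \<subseteq>
      E \<inter> (A - B) \<times> (A - B) \<union> E \<inter> (B \<union> W) \<times> (B \<union> W) \<union> (?X \<union> prod.swap ` ?X)"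
  proof (rule subrelI)
    fix u v assume uv: "(u, v) \<in> E \<inter> A \<times> A"
    then have "(v, u) \<in> E" using assms(4) by (auto dest: symD)
    show "(u, v) \<in> E \<inter> (A - B) \<times> (A - B) \<union> E \<inter> (B \<union> W) \<times> (B \<union> W) \<union> (?X \<union> prod.swap ` ?X)"
    proof (cases "v \<in> B \<and> u \<notin> B \<union> W")
      case True
      then have "(v, u) \<in> ?X" using uv \<open>(v, u) \<in> E\<close> by auto
      then have "(u, v) \<in> prod.swap ` ?X" by force
      then show ?thesis by blast
    qed (use uv in auto)
  qed
  have "card (E \<inter> A \<times> A) \<le> card (E \<inter> (A - B) \<times> (A - B) \<union> E \<inter> (B \<union> W) \<times> (B \<union> W) \<union> (?X \<union> prod.swap ` ?X))"
    using fin sub by (intro card_mono) auto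
  also have "\<dots> \<le> card (E \<inter> (A - B) \<times> (A - B)) + card (E \<inter> (B \<union> W) \<times> (B \<union> W)) + (card ?X + card (prod.swap ` ?X))"
    by (meson add_mono card_Un_le order_trans order_refl)
  also have "card (prod.swap ` ?X) \<le> card ?X"
    using fin by (intro card_image_le)
  finally show ?thesis by (simp add: arcs_in_def)
qed

section \<open>Packing disjoint stars and extracting colour bundles\<close>

lemma card_relation_le:
  assumes "finite B" "R \<subseteq> B \<times> U" "\<And>b. b \<in> B \<Longrightarrow> card (R `` {b}) \<le> d" "finite U"
  shows "card R \<le> card B * d"
proof -
  have "R = Sigma B (\<lambda>b. R `` {b})" using assms(2) by auto
  then have "card R = (\<Sum>b\<in>B. card (R `` {b}))"
    using assms by (metis card_SigmaI finite_Image finite_SigmaI finite_subset)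
  also have "\<dots> \<le> card B * d"
    using sum_bounded_above[of B "\<lambda>b. card (R `` {b})" d] assms(3) by simp
  finally show ?thesis .
qed

lemma ex_maximal_stars:
  fixes M :: "('a \<times> 'a) set"
  assumes "finite B" "finite U" "M \<subseteq> B \<times> U" "0 < k"
    and deg: "\<And>u. u \<in> U \<Longrightarrow> card (M\<inverse> `` {u}) \<le> k"
  obtains \<L> where "finite \<L>" "disjoint \<L>"
    "\<And>L. L \<in> \<L> \<Longrightarrow> card L = k \<and> L \<subseteq> U \<and> (\<exists>b\<in>B. {b} \<times> L \<subseteq> M)"
    "card M \<le> card B * k + card \<L> * k * k"
proof -
  define P where "P \<L> \<longleftrightarrow> disjoint \<L> \<and> (\<forall>L\<in>\<L>. card L = k \<and> L \<subseteq> U \<and> (\<exists>b\<in>B. {b} \<times> L \<subseteq> M))" for \<L>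
  have sub: "{\<L>. P \<L>} \<subseteq> Pow (Pow U)" by (auto simp: P_def)
  have "finite {\<L>. P \<L>}" by (rule finite_subset[OF sub]) (use assms in simp)
  moreover have "{} \<in> {\<L>. P \<L>}" by (simp add: P_def)
  ultimately obtain \<L> where \<L>: "P \<L>" and max: "\<And>\<L>'. P \<L>' \<Longrightarrow> \<L> \<subseteq> \<L>' \<Longrightarrow> \<L>' = \<L>"
    using finite_has_maximal2[of "{\<L>. P \<L>}" "{}"] by auto
  have finL: "finite \<L>" using sub \<L> assms(2) by (auto intro: finite_subset)
  let ?Z = "\<Union>\<L>"
  have Z: "?Z \<subseteq> U" using \<L> by (auto simp: P_def)
  have cZ: "card ?Z \<le> card \<L> * k"
    using card_Union_le_sum_card[of \<L>] \<L> sum_bounded_above[of \<L> card k] by (auto simp: P_def)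
  have small: "card ((M - UNIV \<times> ?Z) `` {b}) \<le> k" if b: "b \<in> B" for b
  proof (rule ccontr)
    assume "\<not> ?thesis"
    then obtain L where L: "L \<subseteq> (M - UNIV \<times> ?Z) `` {b}" "card L = k" "finite L"
      using obtain_subset_with_card_n[of k "(M - UNIV \<times> ?Z) `` {b}"] by auto
    \<comment> \<open>This is where \<open>0 < k\<close> matters: a nonempty set disjoint from
      \<open>?Z\<close> is not yet in \<open>\<L>\<close>, so adding it contradicts
      maximality.\<close>
    have "L \<noteq> {}" using L \<open>0 < k\<close> by auto
    have LZ: "L \<inter> ?Z = {}" using L by auto
    have "P (insert L \<L>)"
      unfolding P_def
    proof (intro conjI ballI)
      show "disjoint (insert L \<L>)"
        using \<L> LZ by (auto simp: P_def pairwise_insert disjnt_def)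
      fix L' assume L': "L' \<in> insert L \<L>"
      show "card L' = k" using L' L \<L> by (auto simp: P_def)
      show "L' \<subseteq> U" using L' L \<L> assms(3) by (auto simp: P_def)
      show "\<exists>b\<in>B. {b} \<times> L' \<subseteq> M" using L' L \<L> b unfolding P_def by blast
    qed
    from max[OF this] have "L \<in> \<L>" by auto
    with LZ \<open>L \<noteq> {}\<close> show False by auto
  qed
  have finM: "finite M" using assms by (auto intro: finite_subset)
  have "card (M - UNIV \<times> ?Z) \<le> card B * k"
    using assms small by (intro card_relation_le[where U = U]) auto
  moreover have "card (M \<inter> UNIV \<times> ?Z) \<le> card \<L> * k * k"
  proof -
    have "card ((M \<inter> UNIV \<times> ?Z)\<inverse>) \<le> card ?Z * k"
    proof (rule card_relation_le[where U = B])
      show "finite ?Z" using Z assms(2) by (rule finite_subset)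
      fix u assume "u \<in> ?Z"
      then have "u \<in> U" using Z by auto
      have "(M \<inter> UNIV \<times> ?Z)\<inverse> `` {u} \<subseteq> M\<inverse> `` {u}" by auto
      then have "card ((M \<inter> UNIV \<times> ?Z)\<inverse> `` {u}) \<le> card (M\<inverse> `` {u})"
        using finM by (intro card_mono) auto
      also have "\<dots> \<le> k" by (rule deg) fact
      finally show "card ((M \<inter> UNIV \<times> ?Z)\<inverse> `` {u}) \<le> k" .
    qed (use assms in auto)
    also have "\<dots> \<le> card \<L> * k * k" using cZ by simp
    finally show ?thesis by simp
  qed
  moreover have "card M = card (M - UNIV \<times> ?Z) + card (M \<inter> UNIV \<times> ?Z)"
    using finM by (subst card_Un_disjoint[symmetric]) (auto intro!: arg_cong[where f = card])
  ultimately have "card M \<le> card B * k + card \<L> * k * k" by linarith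
  with that[of \<L>] finL \<L> show ?thesis by (auto simp: P_def)
qed

text \<open>
  \<open>M\<close> is a set of usable arcs leaving \<open>B\<close>. The bundle \<open>T j\<close> consists either of the colours of the usable
  arcs into one vertex that receives at least \<open>k\<close> of them, or of the colours of a star with \<open>k\<close>
  leaves; different stars have disjoint sets of leaves, but possibly the same centre. If neither
  kind is frequent, then too few arcs leave \<open>B\<close>, contradicting extremality.
\<close>

lemma ex_colour_bundles:
  fixes c :: "'a \<Rightarrow> 'a \<Rightarrow> 'c" and M :: "('a \<times> 'a) set"
  assumes "finite A" "B \<subseteq> A" "B \<noteq> {}" "2 * card B \<le> card A" "sym E"
    and L: "1 \<le> L" "log 2 (card A) \<le> L" and ext: "extremal E (1 / L) A"
    and M: "M \<subseteq> E \<inter> B \<times> (A - B)"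
    and inj1: "\<And>b u u'. (b, u) \<in> M \<Longrightarrow> (b, u') \<in> M \<Longrightarrow> c b u = c b u' \<Longrightarrow> u = u'"
    and inj2: "\<And>b b' u. (b, u) \<in> M \<Longrightarrow> (b', u) \<in> M \<Longrightarrow> c b u = c b' u \<Longrightarrow> b = b'"
    and z: "\<And>b. b \<in> B \<Longrightarrow> card ((E \<inter> B \<times> (A - B) - M) `` {b}) \<le> z"
    and k: "0 < k" "2 * real k ^ 2 \<le> arcs_in E A / card A"
    and zk: "real z + real k < growth L (card A) (card B) * (arcs_in E A / card A)"
  obtains J :: "'a set set" and T where "finite J" "growth L (card A) (card B) * card B \<le> card J"
    "\<And>j. j \<in> J \<Longrightarrow> T j \<subseteq> (\<lambda>(b, u). c b u) ` M \<and> k \<le> card (T j)"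
    "\<And>C. card {j \<in> J. T j \<inter> C \<noteq> {}} \<le> card {u. \<exists>b. (b, u) \<in> M \<and> c b u \<in> C}"
proof -
  define \<gamma> where "\<gamma> = growth L (card A) (card B)"
  define D where "D = arcs_in E A / card A"
  define W where "W = {u \<in> A. k \<le> card (M\<inverse> `` {u})}"
  define U where "U = A - B - W"
  have fin: "finite B" "finite U" "finite W" "finite M"
  proof -
    show "finite B" "finite U" "finite W" using assms by (auto simp: U_def W_def intro: finite_subset)
    have "M \<subseteq> A \<times> A" using M assms(2) by auto
    then show "finite M" using assms(1) by (auto intro: finite_subset)
  qed
  have fin_hit: "finite {u. \<exists>b. (b, u) \<in> M \<and> c b u \<in> C}" for C
    by (rule finite_subset[of _ "snd ` M"]) (use fin in force)+
  show ?thesis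
  proof (cases "\<gamma> * card B \<le> card W")
    case True
    \<comment> \<open>Bundles are indexed by vertex sets in both cases, so that the index type is
      the same; here the indices are singletons.\<close>
    let ?J = "(\<lambda>w. {w}) ` W"
    let ?T = "\<lambda>j. (\<lambda>b. c b (the_elem j)) ` (M\<inverse> `` {the_elem j})"
    show ?thesis
    proof (rule that[of ?J ?T])
      show "finite ?J" using fin by simp
      have "card ?J = card W" by (intro card_image) (auto simp: inj_on_def)
      then show "growth L (card A) (card B) * card B \<le> card ?J"
        using True by (simp add: \<gamma>_def)
      fix j assume "j \<in> ?J"
      then obtain w where w: "w \<in> W" "j = {w}" by auto
      have "inj_on (\<lambda>b. c b w) (M\<inverse> `` {w})" using inj2 by (auto simp: inj_on_def)
      then show "?T j \<subseteq> (\<lambda>(b, u). c b u) ` M \<and> k \<le> card (?T j)"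
        using w by (force simp: card_image W_def)
    next
      fix C
      show "card {j \<in> ?J. ?T j \<inter> C \<noteq> {}} \<le> card {u. \<exists>b. (b, u) \<in> M \<and> c b u \<in> C}"
        by (rule card_inj_on_le[where f = the_elem]) (use fin_hit in \<open>auto simp: inj_on_def\<close>)
    qed
  next
    case False
    have degU: "card ((M \<inter> B \<times> U)\<inverse> `` {u}) \<le> k" if "u \<in> U" for u
    proof -
      have "(M \<inter> B \<times> U)\<inverse> `` {u} \<subseteq> M\<inverse> `` {u}" by auto
      then have "card ((M \<inter> B \<times> U)\<inverse> `` {u}) \<le> card (M\<inverse> `` {u})"
        using fin by (intro card_mono) auto
      then show ?thesis using that by (auto simp: U_def W_def)
    qed
    obtain \<L> where \<L>: "finite \<L>" "disjoint \<L>"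
      "\<And>L. L \<in> \<L> \<Longrightarrow> card L = k \<and> L \<subseteq> U \<and> (\<exists>b\<in>B. {b} \<times> L \<subseteq> M \<inter> B \<times> U)"
      "card (M \<inter> B \<times> U) \<le> card B * k + card \<L> * k * k"
      using ex_maximal_stars[OF fin(1,2) _ k(1) degU] by blast
    \<comment> \<open>Otherwise too few arcs leave \<open>B\<close> for vertices outside
      \<open>W\<close>: the unusable ones and the term \<open>card B * k\<close> contribute less
      than \<open>\<gamma> * D * card B\<close>, and the stars at most half of this, against the
      \<open>3/2 * \<gamma> * D * card B\<close> forced by
      \<open>extremal_expansion\<close>.\<close>
    have many: "\<gamma> * card B \<le> card \<L>"
    proof (rule ccontr)
      assume few: "\<not> ?thesis"
      have Dpos: "0 < D" using k(1) k(2) by (simp add: D_def) (smt (verit) of_nat_0_less_iff zero_less_power)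
      have B0: "0 < real (card B)" using assms(3) fin by (simp add: card_gt_0_iff)
      have "3 * \<gamma> * D * card B \<le> arcs_in E A - arcs_in E (A - B) - arcs_in E (B \<union> W)"
        unfolding \<gamma>_def D_def using assms False
        by (intro extremal_expansion) (auto simp: W_def \<gamma>_def)
      also have "\<dots> \<le> 2 * real (card (E \<inter> B \<times> (A - B - W)))"
        using assms by (intro boundary_le) (auto simp: W_def)
      also have "card (E \<inter> B \<times> (A - B - W)) \<le> card (E \<inter> B \<times> (A - B) - M) + card (M \<inter> B \<times> U)"
      proof -
        have "finite (E \<inter> B \<times> (A - B) - M)"
          by (rule finite_subset[of _ "A \<times> A"]) (use assms in auto)
        then have "card (E \<inter> B \<times> (A - B - W)) \<le> card ((E \<inter> B \<times> (A - B) - M) \<union> (M \<inter> B \<times> U))"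
          using fin by (intro card_mono) (auto simp: U_def)
        also have "\<dots> \<le> card (E \<inter> B \<times> (A - B) - M) + card (M \<inter> B \<times> U)"
          by (rule card_Un_le)
        finally show ?thesis .
      qed
      also have "card (E \<inter> B \<times> (A - B) - M) \<le> card B * z"
        using assms(1) fin z by (intro card_relation_le[where U = A]) auto
      also note \<L>(4)
      finally have "3 * \<gamma> * D * card B \<le> 2 * real (card B * z + (card B * k + card \<L> * k * k))"
        by (simp add: mult_left_mono)
      also have "\<dots> = 2 * card B * (real z + real k) + card \<L> * (2 * real k ^ 2)"
        by (simp add: algebra_simps power2_eq_square)
      also have "card \<L> * (2 * real k ^ 2) \<le> card \<L> * D"
        using k(2) by (intro mult_left_mono) (auto simp: D_def)
      also have "\<dots> \<le> (\<gamma> * card B) * D"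
        using few Dpos by (intro mult_right_mono) auto
      also have "2 * card B * (real z + real k) < 2 * card B * (\<gamma> * D)"
        using zk B0 by (intro mult_strict_left_mono) (auto simp: \<gamma>_def D_def)
      finally show False by (simp add: algebra_simps)
    qed
    from \<L>(3) obtain f where f: "\<And>L. L \<in> \<L> \<Longrightarrow> {f L} \<times> L \<subseteq> M"
      by (metis le_inf_iff)
    let ?T = "\<lambda>L. c (f L) ` L"
    show ?thesis
    proof (rule that[of \<L> ?T])
      show "growth L (card A) (card B) * card B \<le> card \<L>"
        using many by (simp add: \<gamma>_def)
      fix L assume L: "L \<in> \<L>"
      have "inj_on (c (f L)) L" using f[OF L] by (intro inj_onI) (rule inj1[of "f L"], auto)
      then show "?T L \<subseteq> (\<lambda>(b, u). c b u) ` M \<and> k \<le> card (?T L)"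
        using f[OF L] \<L>(3)[OF L] by (force simp: card_image)
    next
      fix C
      let ?H = "{L \<in> \<L>. ?T L \<inter> C \<noteq> {}}"
      \<comment> \<open>One hit leaf represents each hit star; since leaf sets are disjoint,
        different stars get different leaves.\<close>
      define g where "g L = (SOME u. u \<in> L \<and> c (f L) u \<in> C)" for L
      have g: "g L \<in> L \<and> c (f L) (g L) \<in> C" if "L \<in> ?H" for L
        unfolding g_def by (rule someI_ex) (use that in auto)
      show "card ?H \<le> card {u. \<exists>b. (b, u) \<in> M \<and> c b u \<in> C}"
      proof (rule card_inj_on_le[where f = g])
        show "inj_on g ?H"
        proof (rule inj_onI)
          fix L L' assume "L \<in> ?H" "L' \<in> ?H" "g L = g L'"
          then have "g L \<in> L \<inter> L'" using g[of L] g[of L'] by simp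
          then show "L = L'" using disjointD[OF \<L>(2), of L L'] \<open>L \<in> ?H\<close> \<open>L' \<in> ?H\<close> by blast
        qed
        show "g ` ?H \<subseteq> {u. \<exists>b. (b, u) \<in> M \<and> c b u \<in> C}"
        proof (rule image_subsetI)
          fix L assume L: "L \<in> ?H"
          then have "(f L, g L) \<in> M" using f[of L] g[OF L] by auto
          then show "g L \<in> {u. \<exists>b. (b, u) \<in> M \<and> c b u \<in> C}" using g[OF L] by blast
        qed
      qed (rule fin_hit)
    qed (use \<L> in auto)
  qed
qed

text \<open>By \<open>ln (1 + s) \<ge> s - s\<^sup>2\<close> the logarithm drops by at least a
  quarter of the growth rate, which is the fraction \<open>1 / (96 * L)\<close> of its current
  value. Iteration gives geometric decay.\<close>

lemma shrink_log_ratio: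
  fixes L :: real and N b b' :: nat
  assumes L: "1 \<le> L" and b: "0 < b" "2 * b \<le> N" "log 2 N \<le> L"
    and b': "(1 + growth L N b / 2) * b \<le> b'"
  shows "log 2 (N / b') \<le> log 2 (N / b) * (1 - 1 / (96 * L))"
proof -
  define y where "y = log 2 (real N / real b)"
  define \<gamma> where "\<gamma> = growth L N b"
  have N: "2 * real b \<le> N" using b(2) by (simp flip: of_nat_mult)
  have "real N / b \<le> N" using b by (simp add: field_simps)
  then have "y \<le> log 2 N" using b N by (simp add: y_def)
  with b have yL: "y \<le> L" by simp
  have y0: "0 \<le> y" using b N by (simp add: y_def)
  have \<gamma>: "\<gamma> = y / (24 * L)" by (simp add: \<gamma>_def growth_def y_def)
  have \<gamma>01: "0 \<le> \<gamma>" "\<gamma> \<le> 1" using y0 yL L by (auto simp: \<gamma> field_simps)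
  have pos: "0 < (1 + \<gamma> / 2) * b" using b \<gamma>01 by simp
  have "\<gamma> / 2 - (\<gamma> / 2)\<^sup>2 \<le> ln (1 + \<gamma> / 2)"
    using \<gamma>01 by (intro ln_one_plus_pos_lower_bound) auto
  moreover have "(\<gamma> / 2)\<^sup>2 \<le> \<gamma> / 4"
    using \<gamma>01 mult_right_mono[of \<gamma> 1 \<gamma>] by (simp add: power2_eq_square)
  ultimately have "\<gamma> / 4 \<le> ln (1 + \<gamma> / 2)" by linarith
  also have "\<dots> \<le> log 2 (1 + \<gamma> / 2)"
  proof -
    have "ln (1 + \<gamma> / 2) * ln 2 \<le> ln (1 + \<gamma> / 2) * 1"
      using \<gamma>01 ln_le_minus_one[of "2::real"] by (intro mult_left_mono) auto
    then show ?thesis by (simp add: log_def pos_le_divide_eq)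
  qed
  finally have *: "y / (96 * L) \<le> log 2 (1 + \<gamma> / 2)" by (simp add: \<gamma>)
  have "log 2 (N / b') \<le> log 2 (N / ((1 + \<gamma> / 2) * b))"
    using b' pos b N unfolding \<gamma>_def[symmetric]
    by (intro log_mono divide_left_mono) (auto simp: divide_pos_pos)
  also have "\<dots> = y - log 2 (1 + \<gamma> / 2)"
    using b N \<gamma>01 pos by (simp add: y_def log_divide log_mult)
  also have "\<dots> \<le> y * (1 - 1 / (96 * L))"
    using * by (simp add: algebra_simps)
  finally show ?thesis by (simp add: y_def)
qed

section \<open>Rainbow walks\<close>

definition walk_cols :: "('a \<Rightarrow> 'a \<Rightarrow> 'c) \<Rightarrow> 'a list \<Rightarrow> 'c list" where
  "walk_cols c xs = map (\<lambda>(x, y). c x y) (zip xs (tl xs))"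

lemma walk_cols_simps [simp]:
  "walk_cols c [] = []"
  "walk_cols c [x] = []"
  "walk_cols c (x # y # xs) = c x y # walk_cols c (y # xs)"
  by (simp_all add: walk_cols_def)

lemma length_walk_cols [simp]: "length (walk_cols c xs) = length xs - 1"
  by (simp add: walk_cols_def)

lemma walk_cols_glue: "walk_cols c (xs @ x # ys) = walk_cols c (xs @ [x]) @ walk_cols c (x # ys)"
  by (cases ys; induction xs rule: induct_list012) auto

lemma walk_cols_snoc: "xs \<noteq> [] \<Longrightarrow> walk_cols c (xs @ [u]) = walk_cols c xs @ [c (last xs) u]"
  by (induction xs rule: induct_list012) auto

text \<open>Colours are given on ordered pairs but agree on both orientations, so
  \<open>c_proper\<close>, stated for a common tail, also separates arcs with a common head.\<close>

locale edge_coloured_graph =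
  fixes V :: "'a set" and E :: "('a \<times> 'a) set" and c :: "'a \<Rightarrow> 'a \<Rightarrow> 'c"
  assumes finite_V: "finite V" and E_subset: "E \<subseteq> V \<times> V" and sym_E: "sym E"
    and c_commute: "\<And>u v. (u, v) \<in> E \<Longrightarrow> c u v = c v u"
    and c_proper: "\<And>u v w. (u, v) \<in> E \<Longrightarrow> (u, w) \<in> E \<Longrightarrow> c u v = c u w \<Longrightarrow> v = w"
begin

abbreviation colours :: "'c set" where
  "colours \<equiv> (\<lambda>(u, v). c u v) ` E"

lemma finite_E: "finite E"
  using finite_V E_subset by (auto intro: finite_subset)

definition rainbow_walk :: "'a \<Rightarrow> 'a list \<Rightarrow> 'a \<Rightarrow> bool" where
  "rainbow_walk v xs w \<longleftrightarrow> xs \<noteq> [] \<and> hd xs = v \<and> last xs = w \<and>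
     successively (\<lambda>x y. (x, y) \<in> E) xs \<and> distinct (walk_cols c xs)"

text \<open>Walks rather than paths: an extension then needs only a new colour, and repeated
  vertices are cut out at the end. \<open>xs\<close> lists vertices, so \<open>Suc i\<close> of them
  means at most \<open>i\<close> arcs.\<close>

definition reach :: "'a set \<Rightarrow> 'c set \<Rightarrow> 'a \<Rightarrow> nat \<Rightarrow> 'c set \<Rightarrow> 'a set" where
  "reach S F v i Q = {x \<in> V. \<exists>xs. rainbow_walk v xs x \<and> set xs \<inter> S = {} \<and>
     set (walk_cols c xs) \<subseteq> Q - F \<and> length xs \<le> Suc i}"

lemma finite_reach: "finite (reach S F v i Q)"
  using finite_V by (simp add: reach_def)

lemma reach_subset: "reach S F v i Q \<subseteq> V"
  by (auto simp: reach_def)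

lemma reach_start: "v \<in> V \<Longrightarrow> v \<notin> S \<Longrightarrow> v \<in> reach S F v i Q"
  unfolding reach_def rainbow_walk_def by (auto intro!: exI[of _ "[v]"])

lemma reach_mono: "i \<le> j \<Longrightarrow> Q \<subseteq> Q' \<Longrightarrow> reach S F v i Q \<subseteq> reach S F v j Q'"
  unfolding reach_def by fastforce

lemma reach_step:
  assumes "rainbow_walk v xs b" "set xs \<inter> S = {}" "set (walk_cols c xs) \<subseteq> Q - F" "length xs \<le> Suc i"
    and "(b, u) \<in> E" "u \<notin> S" "c b u \<in> C" "c b u \<notin> F" "c b u \<notin> set (walk_cols c xs)"
  shows "u \<in> reach S F v (Suc i) (Q \<union> C)"
  using assms E_subset unfolding reach_def rainbow_walk_def
  by (auto intro!: exI[of _ "xs @ [u]"] simp: walk_cols_snoc successively_append_iff)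

lemma card_neighbours_le:
  assumes "finite F"
  shows "card {u. (b, u) \<in> E \<and> c b u \<in> F} \<le> card F"
  using assms by (intro card_inj_on_le[where f = "c b"]) (auto simp: inj_on_def intro: c_proper)

text \<open>\<open>Q\<close> is fixed and only \<open>C\<close> is random. At each vertex of
  \<open>B\<close> at most \<open>card S + card F + i\<close> arcs are unusable, so
  \<open>ex_colour_bundles\<close> supplies \<open>\<gamma> * card B\<close> bundles, and hitting
  half of them adds \<open>\<gamma> / 2 * card B\<close> vertices.\<close>

lemma reach_grows:
  fixes S F v i Q k and L :: real
  defines "B \<equiv> reach S F v i Q"
  defines "\<gamma> \<equiv> growth L (card V) (card B)" and "D \<equiv> arcs_in E V / card V"
  assumes v: "v \<in> V" "v \<notin> S" and fin: "finite S" "finite F" and p: "0 \<le> p" "p \<le> 1"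
    and L: "1 \<le> L" "log 2 (card V) \<le> L" and ext: "extremal E (1 / L) V"
    and half: "2 * card B \<le> card V"
    and k: "0 < k" "2 * real k ^ 2 \<le> D"
    and budget: "real (card S + card F + i + k) < \<gamma> * D"
  shows "rset_mean colours p
      (\<lambda>C. of_bool (card (reach S F v (Suc i) (Q \<union> C)) < (1 + \<gamma> / 2) * card B)) \<le> 2 * (1 - p) ^ k"
proof -
  have BV: "B \<subseteq> V" by (simp add: B_def reach_subset)
  have finB: "finite B" by (simp add: B_def finite_reach)
  have Bne: "B \<noteq> {}" using reach_start[OF v] by (auto simp: B_def)
  have "\<forall>b\<in>B. \<exists>xs. rainbow_walk v xs b \<and> set xs \<inter> S = {} \<and>
     set (walk_cols c xs) \<subseteq> Q - F \<and> length xs \<le> Suc i"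
    by (auto simp: B_def reach_def)
  then obtain P where P: "\<And>b. b \<in> B \<Longrightarrow> rainbow_walk v (P b) b \<and> set (P b) \<inter> S = {} \<and>
     set (walk_cols c (P b)) \<subseteq> Q - F \<and> length (P b) \<le> Suc i"
    by metis
  \<comment> \<open>The colours of \<open>P b\<close> are excluded only for arcs at
    \<open>b\<close>, so every usable arc extends the designated walk of its tail.\<close>
  define M where "M = {(b, u). (b, u) \<in> E \<and> b \<in> B \<and> u \<notin> B \<and> u \<notin> S \<and>
     c b u \<notin> F \<and> c b u \<notin> set (walk_cols c (P b))}"
  have M_E: "M \<subseteq> E \<inter> B \<times> (V - B)" using E_subset by (auto simp: M_def)
  have unusable: "card ((E \<inter> B \<times> (V - B) - M) `` {b}) \<le> card S + card F + i" if b: "b \<in> B" for b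
  proof -
    let ?X = "\<lambda>F. {u. (b, u) \<in> E \<and> c b u \<in> F}"
    have finX: "finite (?X F)" for F
      by (rule finite_subset[of _ V]) (use E_subset finite_V in auto)
    have "(E \<inter> B \<times> (V - B) - M) `` {b} \<subseteq> S \<union> (?X F \<union> ?X (set (walk_cols c (P b))))"
      by (auto simp: M_def)
    then have "card ((E \<inter> B \<times> (V - B) - M) `` {b}) \<le> card (S \<union> (?X F \<union> ?X (set (walk_cols c (P b)))))"
      using fin finX by (intro card_mono) auto
    also have "\<dots> \<le> card S + (card (?X F) + card (?X (set (walk_cols c (P b)))))"
      by (meson add_left_mono card_Un_le order_trans)
    also have "card (?X F) \<le> card F" using fin(2) by (rule card_neighbours_le)
    also have "card (?X (set (walk_cols c (P b)))) \<le> card (set (walk_cols c (P b)))"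
      by (rule card_neighbours_le) simp
    also have "\<dots> \<le> length (walk_cols c (P b))" by (rule card_length)
    also have "\<dots> \<le> i"
    proof -
      have "length (P b) \<le> Suc i" using P[OF b] by blast
      then show ?thesis by simp
    qed
    finally show ?thesis by simp
  qed
  have inj1: "u = u'" if "(b, u) \<in> M" "(b, u') \<in> M" "c b u = c b u'" for b u u'
    using that c_proper[of b u u'] by (auto simp: M_def)
  \<comment> \<open>The arcs are reversed so that properness at their common head \<open>u\<close>
    applies.\<close>
  have inj2: "b = b'" if "(b, u) \<in> M" "(b', u) \<in> M" "c b u = c b' u" for b b' u
    using that c_proper[of u b b'] c_commute[of b u] c_commute[of b' u] sym_E
    by (auto simp: M_def dest: symD)
  have zk: "real (card S + card F + i) + real k < \<gamma> * (arcs_in E V / card V)"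
    using budget by (simp add: D_def)
  have kD: "2 * real k ^ 2 \<le> arcs_in E V / card V"
    using k(2) by (simp add: D_def)
  have "\<exists>(J :: 'a set set) T. finite J \<and> \<gamma> * card B \<le> card J \<and>
    (\<forall>j\<in>J. T j \<subseteq> (\<lambda>(b, u). c b u) ` M \<and> k \<le> card (T j)) \<and>
    (\<forall>C. card {j \<in> J. T j \<inter> C \<noteq> {}} \<le> card {u. \<exists>b. (b, u) \<in> M \<and> c b u \<in> C})"
    (is "\<exists>J T. ?bundles J T")
  proof (rule ex_colour_bundles[where A = V and B = B and E = E and L = L and M = M and c = c and k = k
        and z = "card S + card F + i", folded \<gamma>_def])
    fix J :: "'a set set" and T
    assume "finite J" "\<gamma> * card B \<le> card J"
      "\<And>j. j \<in> J \<Longrightarrow> T j \<subseteq> (\<lambda>(b, u). c b u) ` M \<and> k \<le> card (T j)"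
      "\<And>C. card {j \<in> J. T j \<inter> C \<noteq> {}} \<le> card {u. \<exists>b. (b, u) \<in> M \<and> c b u \<in> C}"
    then have "?bundles J T" by blast
    then show "\<exists>J T. ?bundles J T" by (intro exI)
  qed (fact finite_V BV Bne half sym_E L ext M_E inj1 inj2 unusable k(1) kD zk)+
  then obtain J :: "'a set set" and T where J: "finite J" "\<gamma> * card B \<le> card J"
    "\<forall>j\<in>J. T j \<subseteq> (\<lambda>(b, u). c b u) ` M \<and> k \<le> card (T j)"
    "\<forall>C. card {j \<in> J. T j \<inter> C \<noteq> {}} \<le> card {u. \<exists>b. (b, u) \<in> M \<and> c b u \<in> C}"
    by (elim exE conjE)
  have grow: "(1 + \<gamma> / 2) * card B \<le> card (reach S F v (Suc i) (Q \<union> C))"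
    if C: "\<not> 2 * card {j \<in> J. T j \<inter> C \<noteq> {}} < card J" for C
  proof -
    let ?N = "{u. \<exists>b. (b, u) \<in> M \<and> c b u \<in> C}"
    have "?N \<subseteq> reach S F v (Suc i) (Q \<union> C)"
    proof safe
      fix u b assume "(b, u) \<in> M" "c b u \<in> C"
      then show "u \<in> reach S F v (Suc i) (Q \<union> C)"
        using P[of b] by (intro reach_step[of v "P b" b]) (auto simp: M_def)
    qed
    moreover have "B \<subseteq> reach S F v (Suc i) (Q \<union> C)"
      unfolding B_def by (rule reach_mono) auto
    ultimately have "card (B \<union> ?N) \<le> card (reach S F v (Suc i) (Q \<union> C))"
      by (intro card_mono finite_reach) auto
    moreover have "card (B \<union> ?N) = card B + card ?N"
    proof (rule card_Un_disjoint[OF finB])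
      show "finite ?N" by (rule finite_subset[OF _ finite_V]) (use M_E in auto)
      show "B \<inter> ?N = {}" by (auto simp: M_def)
    qed
    moreover have "card J \<le> 2 * card ?N" using C J(4)[rule_format, of C] by linarith
    ultimately have "real (card B) + card J / 2 \<le> card (reach S F v (Suc i) (Q \<union> C))" by linarith
    then show ?thesis using J(2) by (simp add: algebra_simps)
  qed
  have "rset_mean colours p
      (\<lambda>C. of_bool (card (reach S F v (Suc i) (Q \<union> C)) < (1 + \<gamma> / 2) * card B))
    \<le> rset_mean colours p (\<lambda>C. of_bool (2 * card {j \<in> J. T j \<inter> C \<noteq> {}} < card J))"
    using p grow by (intro rset_mean_mono) force+
  also have "\<dots> \<le> 2 * (1 - p) ^ k"
  proof (rule rset_mean_few_hits)
    show "finite colours" using finite_E by simp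
    fix j assume "j \<in> J"
    then show "T j \<subseteq> colours \<and> k \<le> card (T j)" using J(3) M_E by (force simp: image_iff)
  qed (use p J in auto)
  finally show ?thesis .
qed

text \<open>The colours are revealed in \<open>R\<close> independent rounds whose union is a random
  half. A union bound over the rounds keeps the logarithmic ratio on the schedule
  \<open>L * (1 - 1 / (96 * L)) ^ i\<close>, which ends below 1.\<close>

lemma reach_half:
  fixes S F v k R m and L :: real
  defines "D \<equiv> arcs_in E V / card V"
  assumes v: "v \<in> V" "v \<notin> S" and fin: "finite S" "finite F"
    and L: "1 \<le> L" "log 2 (card V) \<le> L" and ext: "extremal E (1 / L) V"
    and R: "0 < R" "0 < m" "2 * real (R * m) ^ 2 \<le> D"
    and budget: "24 * L * real (card S + card F + R + R * m) < D"
    and long: "L * (1 - 1 / (96 * L)) ^ R < 1"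
  shows "rset_mean colours (1/2) (\<lambda>Q. of_bool (2 * card (reach S F v R Q) \<le> card V)) \<le> 2 * real R * (1/2) ^ m"
proof -
  \<comment> \<open>As \<open>p\<close> is chosen with \<open>(1 - p) ^ R = 1/2\<close>, this
    \<open>k\<close> gives each round the failure probability \<open>2 * (1/2) ^ m\<close>.\<close>
  define k where "k = R * m"
  define p where "p = 1 - root R (1/2)"
  have p: "0 \<le> p" "p \<le> 1" using R by (auto simp: p_def)
  have pR: "(1 - p) ^ R = 1/2" using R by (simp add: p_def real_root_pow_pos2)
  \<comment> \<open>Having passed half of \<open>V\<close> counts as success at any time, since
    growth is guaranteed only up to that point.\<close>
  define bad where "bad i Q \<longleftrightarrow> 2 * card (reach S F v i Q) \<le> card V \<and>
     L * (1 - 1 / (96 * L)) ^ i < log 2 (card V / card (reach S F v i Q))" for i Q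
  define \<eta> where "\<eta> = 2 * (1 - p) ^ k"
  have \<eta>0: "0 \<le> \<eta>" using p by (simp add: \<eta>_def)
  have fc: "finite colours" using finite_E by simp
  have pos: "0 < card (reach S F v i Q)" for i Q
    using reach_start[OF v] by (auto simp: card_gt_0_iff finite_reach)
  have round: "rset_mean colours p (\<lambda>C. of_bool (bad (Suc i) (Q \<union> C))) \<le> of_bool (bad i Q) + \<eta>"
    if "i < R" for i Q
  proof -
    let ?b = "card (reach S F v i Q)"
    consider "bad i Q" | "card V < 2 * ?b" | "\<not> bad i Q" "2 * ?b \<le> card V" by linarith
    then show ?thesis
    proof cases
      case 1
      have "rset_mean colours p (\<lambda>C. of_bool (bad (Suc i) (Q \<union> C))) \<le> rset_mean colours p (\<lambda>_. 1)"
        using p by (intro rset_mean_mono) auto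
      then show ?thesis using 1 \<eta>0 fc by (simp add: rset_mean_const)
    next
      case 2
      have "?b \<le> card (reach S F v (Suc i) (Q \<union> C))" for C
        by (intro card_mono finite_reach reach_mono) auto
      then have "\<not> bad (Suc i) (Q \<union> C)" for C
        using 2 unfolding bad_def by (metis leD le_trans mult_le_mono2)
      then show ?thesis using \<eta>0 fc by (simp add: rset_mean_const)
    next
      case 3
      let ?\<gamma> = "growth L (card V) ?b"
      let ?y = "log 2 (card V / ?b)"
      have b: "0 < real ?b" "2 * real ?b \<le> card V" using pos 3(2) by (auto simp flip: of_nat_mult)
      \<comment> \<open>At most half is reached so far, so the growth rate is at least
        \<open>1 / (24 * L)\<close> and a single budget serves all rounds.\<close>
      have "1 \<le> ?y" using b by (simp add: le_log_iff field_simps)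
      then have "1 / (24 * L) \<le> ?\<gamma>" using L by (simp add: growth_def divide_right_mono)
      moreover have D0: "0 \<le> D" by (simp add: D_def arcs_in_nonneg)
      ultimately have "D / (24 * L) \<le> ?\<gamma> * D"
        using mult_right_mono[of "1 / (24 * L)" ?\<gamma> D] by simp
      moreover have "real (card S + card F + i + k) < D / (24 * L)"
      proof -
        have "24 * L * real (card S + card F + i + k) \<le> 24 * L * real (card S + card F + R + k)"
          using L that by (intro mult_left_mono) auto
        also have "\<dots> < D" using budget by (simp add: k_def)
        finally show ?thesis using L by (simp add: field_simps)
      qed
      ultimately have budget': "real (card S + card F + i + k) < ?\<gamma> * D" by linarith
      have k': "0 < k" "2 * real k ^ 2 \<le> D" using R by (auto simp: k_def)
      have "bad (Suc i) (Q \<union> C) \<Longrightarrow> card (reach S F v (Suc i) (Q \<union> C)) < (1 + ?\<gamma> / 2) * ?b" for C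
      proof (rule ccontr)
        assume bad: "bad (Suc i) (Q \<union> C)" and "\<not> card (reach S F v (Suc i) (Q \<union> C)) < (1 + ?\<gamma> / 2) * ?b"
        then have "log 2 (card V / card (reach S F v (Suc i) (Q \<union> C))) \<le> ?y * (1 - 1 / (96 * L))"
          using L pos 3(2) by (intro shrink_log_ratio) auto
        also have "\<dots> \<le> (L * (1 - 1 / (96 * L)) ^ i) * (1 - 1 / (96 * L))"
          using 3 L by (intro mult_right_mono) (auto simp: bad_def)
        finally show False using bad by (simp add: bad_def mult_ac)
      qed
      then have "rset_mean colours p (\<lambda>C. of_bool (bad (Suc i) (Q \<union> C))) \<le>
         rset_mean colours p (\<lambda>C. of_bool (card (reach S F v (Suc i) (Q \<union> C)) < (1 + ?\<gamma> / 2) * ?b))"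
        using p by (intro rset_mean_mono) auto
      also have "\<dots> \<le> \<eta>"
        unfolding \<eta>_def using reach_grows[OF v fin p L ext 3(2) k'[unfolded D_def] budget'[unfolded D_def]] .
      finally show ?thesis by simp
    qed
  qed
  \<comment> \<open>By \<open>rset_mean_union\<close>, the colours revealed in \<open>i\<close>
    rounds form a random set of density \<open>1 - (1 - p) ^ i\<close>.\<close>
  have "rset_mean colours (1 - (1 - p) ^ i) (\<lambda>Q. of_bool (bad i Q)) \<le> i * \<eta>" if "i \<le> R" for i
    using that
  proof (induction i)
    case 0
    have cardV: "0 < card V" using finite_V v by (auto simp: card_gt_0_iff)
    have "\<not> bad 0 Q" for Q
    proof -
      have "real (card V) * 1 \<le> card V * real (card (reach S F v 0 Q))"
        using pos[of 0 Q] by (intro mult_left_mono) auto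
      then have "card V / card (reach S F v 0 Q) \<le> card V"
        using pos[of 0 Q] by (simp add: divide_le_eq)
      then have "log 2 (card V / card (reach S F v 0 Q)) \<le> log 2 (card V)"
        using pos[of 0 Q] cardV by (intro log_mono) auto
      then show ?thesis using L by (simp add: bad_def)
    qed
    then show ?case using fc by (simp add: rset_mean_const)
  next
    case (Suc i)
    let ?q = "1 - (1 - p) ^ i"
    have q: "0 \<le> ?q" "?q \<le> 1" using p by (auto simp: power_le_one)
    have "1 - (1 - p) ^ Suc i = ?q + p - ?q * p" by (simp add: algebra_simps)
    then have "rset_mean colours (1 - (1 - p) ^ Suc i) (\<lambda>Q. of_bool (bad (Suc i) Q))
      = rset_mean colours ?q (\<lambda>Q. rset_mean colours p (\<lambda>C. of_bool (bad (Suc i) (Q \<union> C))))"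
      by (simp only: rset_mean_union[OF fc, of ?q p "\<lambda>Q. of_bool (bad (Suc i) Q)"])
    also have "\<dots> \<le> rset_mean colours ?q (\<lambda>Q. of_bool (bad i Q) + \<eta>)"
      using q round Suc.prems by (intro rset_mean_mono) auto
    also have "\<dots> \<le> i * \<eta> + \<eta>"
      using Suc fc by (simp add: rset_mean_add rset_mean_const)
    finally show ?case by (simp add: algebra_simps)
  qed
  from this[of R] have "rset_mean colours (1/2) (\<lambda>Q. of_bool (bad R Q)) \<le> R * \<eta>"
    by (simp add: pR)
  also have "R * \<eta> = 2 * real R * (1/2) ^ m"
    by (simp add: \<eta>_def k_def power_mult pR)
  finally have *: "rset_mean colours (1/2) (\<lambda>Q. of_bool (bad R Q)) \<le> 2 * real R * (1/2) ^ m" .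
  \<comment> \<open>Reaching at most half means a logarithmic ratio of at least 1, and by
    \<open>long\<close> this is behind schedule after \<open>R\<close> rounds.\<close>
  have "2 * card (reach S F v R Q) \<le> card V \<Longrightarrow> bad R Q" for Q
  proof -
    assume h: "2 * card (reach S F v R Q) \<le> card V"
    then have "2 * real (card (reach S F v R Q)) \<le> card V" by (simp flip: of_nat_mult)
    then have "1 \<le> log 2 (card V / card (reach S F v R Q))"
      using pos[of R Q] by (simp add: le_log_iff field_simps)
    then show "bad R Q" using h long unfolding bad_def by linarith
  qed
  then have "rset_mean colours (1/2) (\<lambda>Q. of_bool (2 * card (reach S F v R Q) \<le> card V))
     \<le> rset_mean colours (1/2) (\<lambda>Q. of_bool (bad R Q))"
    by (intro rset_mean_mono) auto
  with * show ?thesis by linarith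
qed

section \<open>Rainbow paths between two prescribed vertices\<close>

definition rainbow_path :: "'a \<Rightarrow> 'a list \<Rightarrow> 'a \<Rightarrow> bool" where
  "rainbow_path v xs w \<longleftrightarrow> rainbow_walk v xs w \<and> distinct xs"

text \<open>Cutting out the segment between two occurrences of a vertex deletes a block from the
  colour list, so the colours stay distinct; induction on the length finishes.\<close>

lemma rainbow_walk_shorten:
  assumes "rainbow_walk v xs w"
  obtains ys where "rainbow_path v ys w" "set ys \<subseteq> set xs"
    "set (walk_cols c ys) \<subseteq> set (walk_cols c xs)" "length ys \<le> length xs"
proof -
  have "\<exists>ys. rainbow_path v ys w \<and> set ys \<subseteq> set xs \<and>
    set (walk_cols c ys) \<subseteq> set (walk_cols c xs) \<and> length ys \<le> length xs"
    using assms
  proof (induction xs rule: length_induct)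
    case (1 xs)
    show ?case
    proof (cases "distinct xs")
      case True
      then show ?thesis using 1(2) by (auto simp: rainbow_path_def)
    next
      case False
      then obtain as y bs cs where xs: "xs = as @ [y] @ bs @ [y] @ cs"
        using not_distinct_decomp by blast
      let ?zs = "as @ y # cs"
      have cols: "walk_cols c xs = walk_cols c (as @ [y]) @ walk_cols c (y # bs @ [y]) @ walk_cols c (y # cs)"
        using walk_cols_glue[of c as y "bs @ y # cs"] walk_cols_glue[of c "y # bs" y cs] by (simp add: xs)
      have "successively (\<lambda>x y. (x, y) \<in> E) (as @ (y # bs) @ (y # cs))"
        using 1(2) by (simp add: rainbow_walk_def xs)
      then have "successively (\<lambda>x y. (x, y) \<in> E) ?zs"
        by (simp only: successively_append_iff list.sel) auto
      moreover have "hd ?zs = hd xs" by (cases as) (auto simp: xs)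
      moreover have "last ?zs = last xs" by (simp add: xs)
      ultimately have "rainbow_walk v ?zs w"
        using 1(2) cols walk_cols_glue[of c as y cs] unfolding rainbow_walk_def by auto
      moreover have "length ?zs < length xs" by (simp add: xs)
      ultimately obtain ys where "rainbow_path v ys w" "set ys \<subseteq> set ?zs"
          "set (walk_cols c ys) \<subseteq> set (walk_cols c ?zs)" "length ys \<le> length ?zs"
        using 1(1)[rule_format, of ?zs] by blast
      then show ?thesis
        using cols walk_cols_glue[of c as y cs] by (intro exI[of _ ys]) (auto simp: xs)
    qed
  qed
  then show ?thesis using that by blast
qed

lemma walk_cols_rev:
  assumes "successively (\<lambda>x y. (x, y) \<in> E) xs"
  shows "walk_cols c (rev xs) = rev (walk_cols c xs)"
  using assms
proof (induction xs rule: induct_list012)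
  case (3 x y zs)
  then show ?case using walk_cols_glue[of c "rev zs" y "[x]"] c_commute[of x y] by simp
qed simp_all

text \<open>
  A random half of the colours lets \<open>v\<close> reach most vertices, and its complement does the same
  for \<open>w\<close>.
\<close>

lemma ex_connecting_path:
  fixes S F v w R m and L :: real
  defines "D \<equiv> arcs_in E V / card V"
  assumes v: "v \<in> V" "v \<notin> S" and w: "w \<in> V" "w \<notin> S" and fin: "finite S" "finite F"
    and L: "1 \<le> L" "log 2 (card V) \<le> L" and ext: "extremal E (1 / L) V"
    and R: "0 < R" "0 < m" "2 * real (R * m) ^ 2 \<le> D" "4 * real R < 2 ^ m"
    and budget: "24 * L * real (card S + card F + R + R * m) < D"
    and long: "L * (1 - 1 / (96 * L)) ^ R < 1"
  obtains xs where "rainbow_path v xs w" "set xs \<inter> S = {}" "set (walk_cols c xs) \<inter> F = {}"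
    "length xs \<le> 2 * R + 1"
proof -
  have fc: "finite colours" using finite_E by simp
  define bad where "bad v Q \<longleftrightarrow> 2 * card (reach S F v R Q) \<le> card V" for v Q
  have few: "rset_mean colours (1/2) (\<lambda>Q. of_bool (bad u Q)) < 1/2" if "u \<in> V" "u \<notin> S" for u
  proof -
    have "rset_mean colours (1/2) (\<lambda>Q. of_bool (bad u Q)) \<le> 2 * real R * (1/2) ^ m"
      unfolding bad_def using that assms by (intro reach_half) auto
    \<comment> \<open>This is the hypothesis \<open>4 * real R < 2 ^ m\<close>; the union bound
      needs each of the two failures to be less likely than 1/2.\<close>
    also have "\<dots> < 1/2"
      using R by (simp add: field_simps)
    finally show ?thesis .
  qed
  have "rset_mean colours (1/2) (\<lambda>Q. of_bool (bad w (colours - Q)))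
      = rset_mean colours (1/2) (\<lambda>Q. of_bool (bad w Q))"
    by (rule rset_mean_half_compl[OF fc])
  with few[OF v] few[OF w]
  have "rset_mean colours (1/2) (\<lambda>Q. of_bool (bad v Q)) +
      rset_mean colours (1/2) (\<lambda>Q. of_bool (bad w (colours - Q))) < 1" by linarith
  from rset_mean_avoid[OF fc _ _ this] obtain Q
    where Q: "\<not> bad v Q" "\<not> bad w (colours - Q)" by auto
  have "reach S F v R Q \<inter> reach S F w R (colours - Q) \<noteq> {}"
  proof
    assume "reach S F v R Q \<inter> reach S F w R (colours - Q) = {}"
    then have "card (reach S F v R Q) + card (reach S F w R (colours - Q))
        = card (reach S F v R Q \<union> reach S F w R (colours - Q))"
      by (simp add: card_Un_disjoint finite_reach)
    also have "\<dots> \<le> card V"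
      using reach_subset by (intro card_mono finite_V) auto
    finally show False using Q by (auto simp: bad_def)
  qed
  then obtain x xs ys where
    xs: "rainbow_walk v xs x" "set xs \<inter> S = {}" "set (walk_cols c xs) \<subseteq> Q - F" "length xs \<le> Suc R" and
    ys: "rainbow_walk w ys x" "set ys \<inter> S = {}" "set (walk_cols c ys) \<subseteq> colours - Q - F" "length ys \<le> Suc R"
    unfolding reach_def by blast
  from xs(1) have xs': "xs = butlast xs @ [x]" by (auto simp: rainbow_walk_def)
  from ys(1) have ys': "rev ys = x # tl (rev ys)"
    by (metis hd_Cons_tl hd_rev rainbow_walk_def rev_is_Nil_conv)
  \<comment> \<open>The meeting vertex \<open>x\<close> ends \<open>xs\<close> and begins
    \<open>rev ys\<close>, so one copy is dropped; hence the length bound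
    \<open>2 * R + 1\<close>.\<close>
  let ?zs = "butlast xs @ rev ys"
  have cols: "walk_cols c ?zs = walk_cols c xs @ rev (walk_cols c ys)"
    using walk_cols_glue[of c "butlast xs" x "tl (rev ys)"] xs' ys' ys(1)
    by (simp add: rainbow_walk_def walk_cols_rev)
  have succ_rev: "successively (\<lambda>x y. (x, y) \<in> E) (rev ys)"
    using ys(1) sym_E unfolding rainbow_walk_def successively_rev
    by (auto elim!: successively_mono dest: symD)
  have "rainbow_walk v ?zs w"
    unfolding rainbow_walk_def
  proof (intro conjI)
    show "?zs \<noteq> []" using ys' by auto
    have "hd ?zs = hd xs"
      using xs' ys' by (metis hd_append list.sel(1))
    then show "hd ?zs = v" using xs(1) by (simp add: rainbow_walk_def)
    show "last ?zs = w" using ys(1) by (simp add: rainbow_walk_def last_rev)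
    have "successively (\<lambda>x y. (x, y) \<in> E) (butlast xs @ [x])"
      using xs(1) xs' by (simp add: rainbow_walk_def)
    then show "successively (\<lambda>x y. (x, y) \<in> E) ?zs"
      using succ_rev ys' by (subst ys', subst (asm) ys') (auto simp: successively_append_iff)
    \<comment> \<open>The two parts use colours from \<open>Q\<close> and from its complement, so no
      colour occurs in both.\<close>
    show "distinct (walk_cols c ?zs)"
      unfolding cols using xs ys by (auto simp: rainbow_walk_def)
  qed
  then obtain zs where zs: "rainbow_path v zs w" "set zs \<subseteq> set ?zs"
    "set (walk_cols c zs) \<subseteq> set (walk_cols c ?zs)" "length zs \<le> length ?zs"
    by (rule rainbow_walk_shorten)
  show ?thesis
  proof (rule that)
    have "set (butlast xs) \<subseteq> set xs" by (auto dest: in_set_butlastD)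
    then show "set zs \<inter> S = {}" using zs(2) xs(2) ys(2) by auto
    show "set (walk_cols c zs) \<inter> F = {}" using zs(3) xs(3) ys(3) unfolding cols by auto
    show "length zs \<le> 2 * R + 1" using zs(4) xs(4) ys(4) by simp
  qed (rule zs(1))
qed

end

section \<open>Assembling the subdivision\<close>

definition path_arcs :: "'a list \<Rightarrow> ('a \<times> 'a) set" where
  "path_arcs xs = set (zip xs (tl xs)) \<union> (set (zip xs (tl xs)))\<inverse>"

lemma path_arcs_simps [simp]:
  "path_arcs [x] = {}"
  "path_arcs (x # y # xs) = {(x, y), (y, x)} \<union> path_arcs (y # xs)"
  by (auto simp: path_arcs_def)

lemma path_arcs_subset: "path_arcs xs \<subseteq> set xs \<times> set xs"
  by (cases xs) (auto simp: path_arcs_def dest: set_zip_leftD set_zip_rightD)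

text \<open>The inner vertices are inserted one at a time: \<open>x\<close> subdivides
  \<open>(u, v)\<close>, then the rest subdivide \<open>(x, v)\<close>. With no inner vertices,
  \<open>path_arcs\<close> restores the deleted pair.\<close>

lemma subdivision_pair_path:
  assumes "subdivision_pair K H" "(u, v) \<in> parcs H" "distinct xs" "set xs \<inter> pverts H = {}"
  shows "subdivision_pair K \<lparr>pverts = pverts H \<union> set xs,
           parcs = parcs H - {(u, v), (v, u)} \<union> path_arcs (u # xs @ [v])\<rparr>"
  using assms
proof (induction xs arbitrary: u H)
  case Nil
  interpret pair_bidirected_digraph H
    using Nil(1) by (rule bidirected_digraphI_subdivision)
  have "parcs H - {(u, v), (v, u)} \<union> path_arcs [u, v] = parcs H"
    using Nil(2) arcs_symmetric by auto
  moreover have "\<lparr>pverts = pverts H, parcs = parcs H\<rparr> = H" by simp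
  ultimately show ?case using Nil(1) by (simp only: list.set Un_empty_right append.simps)
next
  case (Cons x xs)
  interpret pair_bidirected_digraph H
    using Cons.prems(1) by (rule bidirected_digraphI_subdivision)
  have x: "x \<notin> pverts H" "x \<notin> set xs" using Cons.prems by auto
  then have nx: "(x, y) \<notin> parcs H" "(y, x) \<notin> parcs H" for y
    using in_arcsD1 in_arcsD2 by auto
  have uv: "u \<in> pverts H" "v \<in> pverts H" using Cons.prems(2) in_arcsD1 in_arcsD2 by auto
  let ?H = "subdivide H (u, v) x"
  have "subdivision_pair K ?H"
    using Cons.prems x by (intro subdivision_pair_divide) auto
  then have "subdivision_pair K \<lparr>pverts = pverts ?H \<union> set xs,
           parcs = parcs ?H - {(x, v), (v, x)} \<union> path_arcs (x # xs @ [v])\<rparr>"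
    using Cons.prems x by (intro Cons.IH) (auto simp: subdivide.simps)
  moreover have "parcs ?H - {(x, v), (v, x)} = parcs H - {(u, v), (v, u)} \<union> {(u, x), (x, u)}"
    using nx uv x no_loops'[OF Cons.prems(2)] by (auto simp: subdivide.simps)
  ultimately show ?case
    by (cases xs) (simp_all add: subdivide.simps Un_ac insert_commute)
qed

context edge_coloured_graph
begin

definition rainbow_arcs :: "('a \<times> 'a) set \<Rightarrow> bool" where
  "rainbow_arcs X \<longleftrightarrow> (\<forall>a b a' b'. (a, b) \<in> X \<longrightarrow> (a', b') \<in> X \<longrightarrow> c a b = c a' b' \<longrightarrow> {a, b} = {a', b'})"

lemma walk_arcs_subset:
  assumes "successively (\<lambda>x y. (x, y) \<in> E) xs"
  shows "set (zip xs (tl xs)) \<subseteq> E"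
  using assms by (induction xs rule: induct_list012) auto

lemma path_arcs_walk:
  assumes "successively (\<lambda>x y. (x, y) \<in> E) xs"
  shows "path_arcs xs \<subseteq> E" "(\<lambda>(u, v). c u v) ` path_arcs xs = set (walk_cols c xs)"
proof -
  note sub = walk_arcs_subset[OF assms]
  then show "path_arcs xs \<subseteq> E" using sym_E by (auto simp: path_arcs_def dest: symD)
  have "(\<lambda>(u, v). c u v) ` (set (zip xs (tl xs)))\<inverse> = (\<lambda>(u, v). c u v) ` set (zip xs (tl xs))"
    using sub c_commute by (force simp: image_iff)
  then show "(\<lambda>(u, v). c u v) ` path_arcs xs = set (walk_cols c xs)"
    by (simp add: path_arcs_def image_Un walk_cols_def)
qed

lemma rainbow_path_arcs:
  assumes "successively (\<lambda>x y. (x, y) \<in> E) xs" "distinct (walk_cols c xs)"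
  shows "rainbow_arcs (path_arcs xs)"
  unfolding rainbow_arcs_def
proof (intro allI impI)
  note sub = walk_arcs_subset[OF assms(1)]
  have inj: "inj_on (\<lambda>(u, v). c u v) (set (zip xs (tl xs)))"
    using assms(2) by (simp add: walk_cols_def distinct_map)
  have dir: "\<exists>x y. (x, y) \<in> set (zip xs (tl xs)) \<and> {a, b} = {x, y} \<and> c a b = c x y"
    if "(a, b) \<in> path_arcs xs" for a b
    using that sub c_commute unfolding path_arcs_def by fastforce
  fix a b a' b'
  assume "(a, b) \<in> path_arcs xs" "(a', b') \<in> path_arcs xs" and eq: "c a b = c a' b'"
  then obtain x y x' y' where
    "(x, y) \<in> set (zip xs (tl xs))" "{a, b} = {x, y}" "c a b = c x y"
    "(x', y') \<in> set (zip xs (tl xs))" "{a', b'} = {x', y'}" "c a' b' = c x' y'"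
    using dir by meson
  with eq inj_onD[OF inj, of "(x, y)" "(x', y')"] show "{a, b} = {a', b'}" by simp
qed

text \<open>Greedy construction: starting from the abstract complete graph on \<open>Bv\<close>,
  whose arcs need not lie in \<open>E\<close>, each pair is replaced by a rainbow path avoiding all
  vertices and colours used before. At most \<open>t\<^sup>2\<close> paths, each with at most
  \<open>l\<close> arcs, explain the size bounds in \<open>connect\<close>.\<close>

lemma ex_rainbow_clique_subdivision:
  assumes Bv: "Bv \<subseteq> V" "card Bv = t" "finite Bv"
    and connect: "\<And>v w S F. \<lbrakk>v \<in> V - S; w \<in> V - S; finite S; finite F;
        card S \<le> t + t\<^sup>2 * l; card F \<le> t\<^sup>2 * l\<rbrakk> \<Longrightarrow>
      \<exists>xs. rainbow_path v xs w \<and> set xs \<inter> S = {} \<and> set (walk_cols c xs) \<inter> F = {} \<and> length xs \<le> l + 1"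
  shows "\<exists>H :: 'a pair_pre_digraph. pverts H \<subseteq> V \<and> parcs H \<subseteq> E \<and> is_clique_subdivision t H \<and>
    rainbow_arcs (parcs H)"
proof -
  define K where "K = \<lparr>pverts = Bv, parcs = {(u, v). (u, v) \<in> Bv \<times> Bv \<and> u \<noteq> v}\<rparr>"
  have K: "complete_digraph t (with_proj K)"
    unfolding complete_digraph_pair_def by (simp add: K_def Bv)
  interpret K: pair_graph K by (rule pair_graphI_complete[OF K])
  have bidir: "pair_bidirected_digraph K" by unfold_locales
  obtain enum where enum: "bij_betw enum {0..<t} Bv"
    using ex_bij_betw_nat_finite[OF Bv(3)] Bv(2) by auto
  \<comment> \<open>One orientation of each pair of branch vertices, chosen through an enumeration
    because the vertex type carries no order.\<close>
  define \<P> where "\<P> = (\<lambda>(i, j). (enum i, enum j)) ` {(i, j). i < j \<and> j < t}"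
  have enum_in: "enum i \<in> Bv" if "i < t" for i using enum that by (auto simp: bij_betw_def)
  have enum_eq: "enum i = enum j \<longleftrightarrow> i = j" if "i < t" "j < t" for i j
    using enum that by (auto simp: bij_betw_def inj_on_def)
  have \<P>B: "\<P> \<subseteq> Bv \<times> Bv" using enum_in by (auto simp: \<P>_def)
  have finP: "finite \<P>" by (rule finite_subset[OF \<P>B]) (use Bv in auto)
  have cardP: "card \<P> \<le> t\<^sup>2"
    using card_mono[OF _ \<P>B] Bv by (simp add: card_cartesian_product power2_eq_square)
  have asym: "u \<noteq> v" "(v, u) \<notin> \<P>" if "(u, v) \<in> \<P>" for u v
    using that enum_eq by (auto simp: \<P>_def)
  have total: "(u, v) \<in> \<P> \<union> \<P>\<inverse>" if "u \<in> Bv" "v \<in> Bv" "u \<noteq> v" for u v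
  proof -
    have "u \<in> enum ` {0..<t}" "v \<in> enum ` {0..<t}" using that enum by (auto simp: bij_betw_def)
    then obtain i j where ij: "i < t" "j < t" "u = enum i" "v = enum j"
      by (elim imageE) auto
    have "i \<noteq> j" using that(3) ij by auto
    then have "i < j \<or> j < i" by linarith
    then show ?thesis using ij by (auto simp: \<P>_def)
  qed
  have parcsK: "parcs K = \<P> \<union> \<P>\<inverse>"
    using total asym \<P>B by (auto simp: K_def)
  \<comment> \<open>\<open>Z\<close> holds the pairs already treated and \<open>X\<close> the arcs
    of their paths; the other arcs of \<open>H\<close> are placeholders inherited from
    \<open>K\<close>.\<close>
  define inv where "inv Z H X \<longleftrightarrow> subdivision_pair K H \<and> Bv \<subseteq> pverts H \<and> pverts H \<subseteq> V \<and>
      finite (pverts H) \<and> card (pverts H) \<le> t + card Z * l \<and>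
      parcs H = (\<P> - Z) \<union> (\<P> - Z)\<inverse> \<union> X \<and> X \<subseteq> E \<and> X \<subseteq> pverts H \<times> pverts H \<and> rainbow_arcs X \<and>
      card ((\<lambda>(u, v). c u v) ` X) \<le> card Z * l" for Z H X
  have "\<exists>H X. inv Z H X" if "finite Z" "Z \<subseteq> \<P>" for Z
    using that
  proof (induction Z)
    case empty
    have "inv {} K {}"
      unfolding inv_def using subdivision_pair_base[OF bidir] Bv parcsK
      by (auto simp: K_def rainbow_arcs_def)
    then show ?case by blast
  next
    case (insert e Z)
    then obtain H X where H: "inv Z H X" by auto
    obtain u v where e: "e = (u, v)" by (cases e)
    have uvP: "(u, v) \<in> \<P>" using insert.prems e by auto
    have uv: "u \<in> Bv" "v \<in> Bv" "u \<noteq> v" "(v, u) \<notin> \<P>" using uvP \<P>B asym by auto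
    let ?S = "pverts H - {u, v}" and ?F = "(\<lambda>(u, v). c u v) ` X"
    have "card Z * l \<le> t\<^sup>2 * l"
      using card_mono[OF finP, of Z] insert.prems cardP by (intro mult_right_mono) auto
    moreover have "card (pverts H) \<le> t + card Z * l" "card ?F \<le> card Z * l"
      using H by (simp_all add: inv_def)
    ultimately have size: "card (pverts H) \<le> t + t\<^sup>2 * l" "card ?F \<le> t\<^sup>2 * l"
      by linarith+
    have "\<exists>xs. rainbow_path u xs v \<and> set xs \<inter> ?S = {} \<and> set (walk_cols c xs) \<inter> ?F = {} \<and> length xs \<le> l + 1"
    proof (rule connect)
      show "u \<in> V - ?S" "v \<in> V - ?S" using uv Bv by auto
      show "finite ?S" using H by (simp add: inv_def)
      show "finite ?F" using H finite_E by (auto simp: inv_def intro: finite_subset)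
      show "card ?S \<le> t + t\<^sup>2 * l"
        using size(1) card_mono[of "pverts H" ?S] H by (auto simp: inv_def)
      show "card ?F \<le> t\<^sup>2 * l" by (rule size)
    qed
    then obtain xs where xs: "rainbow_path u xs v" "set xs \<inter> ?S = {}"
      "set (walk_cols c xs) \<inter> ?F = {}" "length xs \<le> l + 1" by blast
    have xs': "distinct xs" "successively (\<lambda>x y. (x, y) \<in> E) xs" "distinct (walk_cols c xs)" "xs \<noteq> []"
      "hd xs = u" "last xs = v"
      using xs(1) by (auto simp: rainbow_path_def rainbow_walk_def)
    obtain ys where ys: "xs = u # ys @ [v]"
      using xs'(4-6) uv(3) by (metis append_butlast_last_id last_ConsL last_ConsR list.collapse)
    have yH: "set ys \<inter> pverts H = {}" using xs(2) xs'(1) by (auto simp: ys)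
    have yV: "set ys \<subseteq> V"
    proof
      fix y assume "y \<in> set ys"
      then obtain as bs where "ys = as @ y # bs" by (auto simp: in_set_conv_decomp)
      then have "(last (u # as), y) \<in> E"
        using xs'(2) by (simp add: ys successively_append_iff flip: append_Cons)
      then show "y \<in> V" using E_subset by auto
    qed
    let ?H = "\<lparr>pverts = pverts H \<union> set ys, parcs = parcs H - {(u, v), (v, u)} \<union> path_arcs (u # ys @ [v])\<rparr>"
    \<comment> \<open>The subtraction mirrors the deletion in \<open>?H\<close>, so the equation for
      \<open>parcs ?H\<close> follows without showing that \<open>X\<close> avoids this pair. If the
      path is the edge itself, \<open>path_arcs xs\<close> puts it back.\<close>
    let ?X = "X - {(u, v), (v, u)} \<union> path_arcs xs"
    have cardy: "card (set ys) \<le> l" using xs(4) card_length[of ys] by (simp add: ys)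
    have cardZ: "card (insert e Z) = Suc (card Z)" using insert.hyps by simp
    have cols: "(\<lambda>(u, v). c u v) ` path_arcs xs = set (walk_cols c xs)" "path_arcs xs \<subseteq> E"
      using path_arcs_walk[OF xs'(2)] by auto
    have "inv (insert e Z) ?H ?X"
      unfolding inv_def
    proof (intro conjI)
      have "(u, v) \<in> parcs H" using H uvP insert.hyps(2) by (auto simp: inv_def e)
      then show "subdivision_pair K ?H"
        using H xs'(1) yH by (intro subdivision_pair_path) (auto simp: inv_def ys)
      show "Bv \<subseteq> pverts ?H" "pverts ?H \<subseteq> V" "finite (pverts ?H)"
        using H yV by (auto simp: inv_def)
      have "card (pverts ?H) \<le> card (pverts H) + card (set ys)"
        using card_Un_le by simp
      then show "card (pverts ?H) \<le> t + card (insert e Z) * l"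
        using H cardy unfolding cardZ inv_def by simp
      have "(\<P> - insert e Z) \<union> (\<P> - insert e Z)\<inverse> = (\<P> - Z) \<union> (\<P> - Z)\<inverse> - {(u, v), (v, u)}"
        using uv(4) by (auto simp: e)
      then show "parcs ?H = (\<P> - insert e Z) \<union> (\<P> - insert e Z)\<inverse> \<union> ?X"
        using H by (auto simp: inv_def ys)
      show "?X \<subseteq> E" using H cols by (auto simp: inv_def)
      have "set xs \<subseteq> pverts ?H" using uv H by (auto simp: ys inv_def)
      then have "path_arcs xs \<subseteq> pverts ?H \<times> pverts ?H" using path_arcs_subset[of xs] by blast
      then show "?X \<subseteq> pverts ?H \<times> pverts ?H" using H by (auto simp: inv_def)
      show "rainbow_arcs ?X"
        unfolding rainbow_arcs_def
      proof (intro allI impI)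
        fix a b a' b'
        assume ab: "(a, b) \<in> ?X" "(a', b') \<in> ?X" "c a b = c a' b'"
        have new: "c x y \<in> set (walk_cols c xs)" if "(x, y) \<in> path_arcs xs" for x y
          using that cols(1) by force
        have old: "c x y \<in> ?F" if "(x, y) \<in> X" for x y using that by force
        \<comment> \<open>The new path avoids the colours of \<open>X\<close>, so equally coloured
          arcs are both old or both new.\<close>
        have "(a, b) \<in> X \<and> (a', b') \<in> X \<or> (a, b) \<in> path_arcs xs \<and> (a', b') \<in> path_arcs xs"
          using ab new[of a b] new[of a' b'] old[of a b] old[of a' b'] xs(3) by auto
        moreover have "rainbow_arcs X" using H by (simp add: inv_def)
        moreover have "rainbow_arcs (path_arcs xs)" using xs'(2,3) by (rule rainbow_path_arcs)
        ultimately show "{a, b} = {a', b'}"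
          using ab(3) unfolding rainbow_arcs_def by meson
      qed
      have finF: "finite ?F" using H finite_E by (auto simp: inv_def intro: finite_subset)
      have "card ((\<lambda>(u, v). c u v) ` ?X) \<le> card (?F \<union> set (walk_cols c xs))"
        using finF cols(1) by (intro card_mono) auto
      also have "\<dots> \<le> card ?F + card (set (walk_cols c xs))" by (rule card_Un_le)
      also have "card (set (walk_cols c xs)) \<le> l"
        using xs(4) card_length[of "walk_cols c xs"] by simp
      also have "card ?F \<le> card Z * l" using H by (simp add: inv_def)
      finally show "card ((\<lambda>(u, v). c u v) ` ?X) \<le> card (insert e Z) * l"
        unfolding cardZ by simp
    qed
    then show ?case by blast
  qed
  from this[OF finP] obtain H X where "inv \<P> H X" by auto
  then have "subdivision_pair K H" "pverts H \<subseteq> V" "parcs H \<subseteq> E" "rainbow_arcs (parcs H)"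
    by (auto simp: inv_def)
  with K show ?thesis unfolding is_clique_subdivision_def by blast
qed

end

section \<open>Choice of parameters\<close>

text \<open>\<open>R\<close> about \<open>192 * L * ln L\<close> brings the schedule down to
  \<open>1 / L\<close>, and \<open>m\<close> about \<open>4 * ln L\<close> makes
  \<open>2 ^ m\<close> at least \<open>L powr 2\<close>. The last two conditions are then of order
  \<open>L powr 2\<close> times powers of \<open>ln L\<close>, absorbed by
  \<open>\<epsilon>\<close>. The constants 4 and 48 are doubled because passing to the extremal set
  may halve the degree.\<close>

lemma ex_parameters:
  fixes t :: nat and \<epsilon> :: real
  assumes "\<epsilon> > 0"
  shows "\<forall>\<^sub>F L in at_top. \<exists>R m. 0 < R \<and> 0 < m \<and> 4 * real R < 2 ^ m \<and>
    L * (1 - 1 / (96 * L)) ^ R < 1 \<and> 4 * real (R * m) ^ 2 \<le> L powr (2 + \<epsilon>) \<and>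
    48 * L * (t + 4 * real (t\<^sup>2) * R + R + R * m) < L powr (2 + \<epsilon>)"
proof -
  have 1: "\<forall>\<^sub>F L::real in at_top. 4 * (192 * L * ln L + 1) < L powr 2"
    by real_asymp
  have 2: "\<forall>\<^sub>F L::real in at_top. 4 * ((192 * L * ln L + 1) * (4 * ln L + 1)) ^ 2 \<le> L powr (2 + \<epsilon>)"
    using assms by real_asymp
  have 3: "\<forall>\<^sub>F L::real in at_top. 48 * L * (real t + 4 * real (t\<^sup>2) * (192 * L * ln L + 1) +
     (192 * L * ln L + 1) + (192 * L * ln L + 1) * (4 * ln L + 1)) < L powr (2 + \<epsilon>)"
    using assms by real_asymp
  show ?thesis
    using 1 2 3 eventually_gt_at_top[of 1]
  proof eventually_elim
    case (elim L)
    define R where "R = nat \<lceil>192 * L * ln L\<rceil>"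
    define m where "m = nat \<lceil>4 * ln L\<rceil>"
    have lnL: "0 < ln L" using elim by simp
    have pos: "0 < 192 * L * ln L" "0 < 4 * ln L" using elim lnL by auto
    have R: "192 * L * ln L \<le> R" "real R \<le> 192 * L * ln L + 1" "0 < R"
      using pos unfolding R_def by linarith+
    have m: "4 * ln L \<le> m" "real m \<le> 4 * ln L + 1" "0 < m"
      using pos unfolding m_def by linarith+
    have Rm: "real R * real m \<le> (192 * L * ln L + 1) * (4 * ln L + 1)"
      using R m pos by (intro mult_mono) auto
    have "4 * real R \<le> 4 * (192 * L * ln L + 1)" using R by simp
    also have "\<dots> < L powr 2" by (rule elim)
    also have "\<dots> \<le> 2 powr (4 * ln L)"
    proof -
      have "2 * ln L \<le> (4 * ln 2) * ln L"
        using lnL ln_le_minus_one[of "1/2"] by (intro mult_right_mono) (auto simp: ln_div)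
      then show ?thesis using elim by (simp add: powr_def mult_ac)
    qed
    also have "\<dots> \<le> 2 powr real m" using m by (intro powr_mono) auto
    also have "\<dots> = 2 ^ m" by (simp add: powr_realpow)
    finally have c1: "4 * real R < 2 ^ m" .
    have "(1 - 1 / (96 * L)) ^ R \<le> exp (- (1 / (96 * L))) ^ R"
      using elim exp_ge_add_one_self[of "- (1 / (96 * L))"] by (intro power_mono) auto
    also have "\<dots> = exp (- (R / (96 * L)))"
      by (simp flip: exp_of_nat_mult)
    also have "\<dots> \<le> exp (- (2 * ln L))"
      using R elim by (simp add: field_simps)
    also have "\<dots> = 1 / (L * L)"
    proof -
      have "exp (2 * ln L) = L * L"
        using \<open>1 < L\<close> by (simp add: exp_double power2_eq_square)
      then show ?thesis by (simp add: exp_minus inverse_eq_divide)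
    qed
    finally have "L * (1 - 1 / (96 * L)) ^ R \<le> L * (1 / (L * L))"
      using elim by (intro mult_left_mono) auto
    also have "\<dots> < 1" using elim by simp
    finally have c2: "L * (1 - 1 / (96 * L)) ^ R < 1" .
    have "real (R * m) ^ 2 \<le> ((192 * L * ln L + 1) * (4 * ln L + 1)) ^ 2"
      using Rm by (intro power_mono) auto
    then have c3: "4 * real (R * m) ^ 2 \<le> L powr (2 + \<epsilon>)"
      using elim by linarith
    have "48 * L * (t + 4 * real (t\<^sup>2) * R + R + R * m) \<le>
      48 * L * (real t + 4 * real (t\<^sup>2) * (192 * L * ln L + 1) +
     (192 * L * ln L + 1) + (192 * L * ln L + 1) * (4 * ln L + 1))"
      using elim R Rm by (intro mult_left_mono add_mono) auto
    also have "\<dots> < L powr (2 + \<epsilon>)" by (rule elim)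
    finally show ?case using c1 c2 c3 R m by auto
  qed
qed

section \<open>Applying the construction inside an extremal vertex set\<close>

lemma average_degree_eq:
  assumes "pair_graph G"
  shows "average_degree G = card (parcs G) / card (pverts G)"
proof -
  interpret pair_graph G by fact
  have "(\<Sum>v\<in>pverts G. \<Sum>e\<in>{e \<in> parcs G. fst e = v}. 1) = (\<Sum>e\<in>parcs G. 1 :: real)"
    using pair_finite_arcs pair_finite_verts in_arcsD1 by (intro sum.group) auto
  then show ?thesis
    by (simp add: average_degree_def out_degree_def out_arcs_def)
qed

text \<open>The reason for the exponent \<open>1 / log 2 n\<close>: shrinking a set of
  \<open>n\<close> vertices, even down to one, loses at most a factor 2 in density.\<close>

lemma inverse_root_log:
  assumes "1 < (n :: real)"
  shows "(1 / n) powr (1 / log 2 n) = 1 / 2"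
proof -
  have "ln n \<noteq> 0" using assms by simp
  then have "(1 / n) powr (1 / log 2 n) = exp (- ln 2)"
    using assms by (simp add: powr_def log_def ln_div)
  then show ?thesis by (simp add: exp_minus inverse_eq_divide)
qed

lemma subgraph_with_proj:
  assumes "wf_digraph (with_proj G)" "wf_digraph (with_proj H)" "pverts H \<subseteq> pverts G" "parcs H \<subseteq> parcs G"
  shows "subgraph (with_proj H) (with_proj G)"
  using assms by (simp add: subgraph_def compatible_def)

theorem theorem1p1:
  fixes t :: nat and \<epsilon> :: real
  assumes "t > 0" and "\<epsilon> > 0"
  shows "\<exists>n0::nat. \<forall>n\<ge>n0. \<forall>(G :: 'a pair_pre_digraph) (col :: 'a set \<Rightarrow> 'c).
           pair_graph G \<and> card (pverts G) = n \<and> proper_edge_coloring G col \<and>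
           average_degree G \<ge> (log 2 (real n)) powr (2 + \<epsilon>) \<longrightarrow>
           (\<exists>H :: 'a pair_pre_digraph.
              subgraph (with_proj H) (with_proj G) \<and> is_clique_subdivision t H \<and> rainbow col H)"
proof -
  obtain L0 where L0: "\<And>L. L0 \<le> L \<Longrightarrow> \<exists>R m. 0 < R \<and> 0 < m \<and> 4 * real R < 2 ^ m \<and>
    L * (1 - 1 / (96 * L)) ^ R < 1 \<and> 4 * real (R * m) ^ 2 \<le> L powr (2 + \<epsilon>) \<and>
    48 * L * (t + 4 * real (t\<^sup>2) * R + R + R * m) < L powr (2 + \<epsilon>)"
    using ex_parameters[OF assms(2), of t] unfolding eventually_at_top_linorder by blast
  \<comment> \<open>This makes \<open>L = log 2 n\<close> at least \<open>max L0 1\<close> for all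
    \<open>n \<ge> n0\<close>.\<close>
  define n0 where "n0 = nat \<lceil>2 powr (max L0 1)\<rceil>"
  show ?thesis
  proof (intro exI[of _ n0] allI impI)
    fix n and G :: "'a pair_pre_digraph" and col :: "'a set \<Rightarrow> 'c"
    assume n: "n0 \<le> n" and hyp: "pair_graph G \<and> card (pverts G) = n \<and> proper_edge_coloring G col \<and>
           average_degree G \<ge> (log 2 (real n)) powr (2 + \<epsilon>)"
    interpret G: pair_graph G using hyp by simp
    define L where "L = log 2 (real n)"
    define c where "c u v = col {u, v}" for u v
    have big: "2 powr (max L0 1) \<le> real n" using n unfolding n0_def by linarith
    have npos: "0 < real n" by (rule less_le_trans[OF _ big]) simp
    then have "max L0 1 \<le> L"
      using big unfolding L_def by (subst le_log_iff) auto
    then have L: "L0 \<le> L" "1 \<le> L" by auto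
    have n1: "1 < real n" using L(2) npos by (simp add: L_def le_log_iff)
    obtain R m where Rm: "0 < R" "0 < m" "4 * real R < 2 ^ m" "L * (1 - 1 / (96 * L)) ^ R < 1"
      "4 * real (R * m) ^ 2 \<le> L powr (2 + \<epsilon>)"
      "48 * L * (t + 4 * real (t\<^sup>2) * R + R + R * m) < L powr (2 + \<epsilon>)"
      using L0[OF L(1)] by blast
    have cardG: "card (pverts G) = n" using hyp by simp
    then have ne: "pverts G \<noteq> {}" using npos by auto
    obtain A where A: "A \<subseteq> pverts G" "A \<noteq> {}" "extremal (parcs G) (1 / L) A"
      "arcs_in (parcs G) (pverts G) * (card A / card (pverts G)) powr (1 + 1 / L) \<le> arcs_in (parcs G) A"
      using ex_extremal[OF G.pair_finite_verts ne] by blast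
    have finA: "finite A" using A(1) G.pair_finite_verts by (rule finite_subset)
    define N where "N = real (card A)"
    have N: "1 \<le> N" "N \<le> n"
      using A finA cardG card_mono[OF G.pair_finite_verts A(1)]
      by (auto simp: N_def Suc_le_eq card_gt_0_iff)
    \<comment> \<open>The locale wants arcs inside \<open>A\<close> only; arc counts of subsets of
      \<open>A\<close> do not change.\<close>
    define E where "E = parcs G \<inter> A \<times> A"
    have E_arcs: "arcs_in E B = arcs_in (parcs G) B" if "B \<subseteq> A" for B
    proof -
      have "E \<inter> B \<times> B = parcs G \<inter> B \<times> B" using that by (auto simp: E_def)
      then show ?thesis by (simp add: arcs_in_def)
    qed
    define D where "D = arcs_in E A / card A"
    have D: "L powr (2 + \<epsilon>) \<le> 2 * D"
    proof -
      have "parcs G \<inter> pverts G \<times> pverts G = parcs G"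
        using G.arc_fst_in_verts G.arc_snd_in_verts by force
      then have avg: "L powr (2 + \<epsilon>) \<le> arcs_in (parcs G) (pverts G) / n"
        using hyp average_degree_eq[of G] by (simp add: arcs_in_def L_def)
      have "1 / 2 = (1 / n) powr (1 / L)"
        unfolding L_def using inverse_root_log[OF n1] by simp
      also have "\<dots> \<le> (N / n) powr (1 / L)"
        using N n1 L by (intro powr_mono2 divide_right_mono) auto
      finally have "(N / n) * (1 / 2) \<le> (N / n) * (N / n) powr (1 / L)"
        using N by (intro mult_left_mono) auto
      also have "\<dots> = (N / n) powr (1 + 1 / L)"
        using N n1 by (simp add: powr_add)
      finally have "arcs_in (parcs G) (pverts G) * (N / n * (1 / 2)) \<le>
          arcs_in (parcs G) (pverts G) * (N / n) powr (1 + 1 / L)"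
        by (intro mult_left_mono arcs_in_nonneg)
      also have "\<dots> \<le> arcs_in E A"
        using A(4) E_arcs[of A] by (simp add: N_def cardG)
      finally have "arcs_in (parcs G) (pverts G) / n * N \<le> 2 * arcs_in E A"
        by (simp add: mult_ac)
      then have "arcs_in (parcs G) (pverts G) / n \<le> 2 * arcs_in E A / N"
        using N by (subst pos_le_divide_eq) auto
      then have "arcs_in (parcs G) (pverts G) / n \<le> 2 * D"
        by (simp add: D_def N_def)
      with avg show ?thesis by linarith
    qed
    interpret edge_coloured_graph A E c
    proof
      show "finite A" by (rule finA)
      show "E \<subseteq> A \<times> A" by (simp add: E_def)
      show "sym E" using G.arcs_symmetric by (auto simp: E_def sym_def)
      show "c u v = c v u" for u v by (simp add: c_def insert_commute)
      show "v = w" if "(u, v) \<in> E" "(u, w) \<in> E" "c u v = c u w" for u v w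
      proof (rule ccontr)
        assume "v \<noteq> w"
        then have meet: "{u, v} \<noteq> {u, w} \<and> {u, v} \<inter> {u, w} \<noteq> {}"
          by (auto simp: doubleton_eq_iff)
        have edges: "{u, v} \<in> uedges G" "{u, w} \<in> uedges G"
          using that by (auto simp: uedges_def E_def)
        have "proper_edge_coloring G col" using hyp by blast
        from this[unfolded proper_edge_coloring_def, rule_format, OF edges meet] that(3)
        show False by (simp add: c_def)
      qed
    qed
    have ext: "extremal E (1 / L) A"
      using A(3) by (simp add: extremal_def E_arcs)
    have logA: "log 2 (card A) \<le> L"
      using N n1 by (simp add: L_def N_def)
    have budget: "24 * L * (t + 4 * real (t\<^sup>2) * R + R + real R * real m) < D"
      using Rm(6) D by linarith
    \<comment> \<open>This makes room for the branch vertices: the budget forces \<open>D\<close>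
      above \<open>t\<close>, hence \<open>t \<le> card A\<close>.\<close>
    have "D \<le> card A"
    proof -
      have "arcs_in E A \<le> real (card (A \<times> A))"
        unfolding arcs_in_def using finA by (intro of_nat_mono card_mono) auto
      then show ?thesis using N by (simp add: D_def card_cartesian_product divide_le_eq flip: N_def)
    qed
    moreover have "real t \<le> 24 * L * (t + 4 * real (t\<^sup>2) * R + R + real R * real m)"
    proof -
      have "1 * real t \<le> 24 * L * (t + 4 * real (t\<^sup>2) * R + R + real R * real m)"
        using L by (intro mult_mono) auto
      then show ?thesis by simp
    qed
    ultimately have "t \<le> card A" using budget by linarith
    then obtain Bv where Bv: "Bv \<subseteq> A" "card Bv = t" "finite Bv"
      by (rule obtain_subset_with_card_n)
    have "\<exists>xs. rainbow_path v xs w \<and> set xs \<inter> S = {} \<and> set (walk_cols c xs) \<inter> F = {} \<and> length xs \<le> 2 * R + 1"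
      if ends: "v \<in> A - S" "w \<in> A - S" and fin: "finite S" "finite F"
        and sizes: "card S \<le> t + t\<^sup>2 * (2 * R)" "card F \<le> t\<^sup>2 * (2 * R)" for v w S F
    proof -
      \<comment> \<open>Each path has at most \<open>2 * R\<close> arcs, and vertices and colours
        together give \<open>t + 2 * t\<^sup>2 * (2 * R)\<close>; this is the term
        \<open>4 * t\<^sup>2 * R\<close> in \<open>ex_parameters\<close>.\<close>
      have "real (card S + card F) \<le> real (t + 4 * t\<^sup>2 * R)"
        using sizes by (intro of_nat_mono) linarith
      then have "24 * L * real (card S + card F + R + R * m) \<le> 24 * L * (t + 4 * real (t\<^sup>2) * R + R + real R * real m)"
        using L by (intro mult_left_mono) auto
      also have "\<dots> < D" by (rule budget)
      finally have bud: "24 * L * real (card S + card F + R + R * m) < arcs_in E A / card A"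
        by (simp add: D_def)
      have sq: "2 * real (R * m) ^ 2 \<le> arcs_in E A / card A"
        using Rm(5) D unfolding D_def by linarith
      obtain xs where "rainbow_path v xs w" "set xs \<inter> S = {}" "set (walk_cols c xs) \<inter> F = {}"
          "length xs \<le> 2 * R + 1"
        by (rule ex_connecting_path[OF _ _ _ _ fin L(2) logA ext Rm(1,2) sq Rm(3) bud Rm(4), of v w])
          (use ends in auto)
      then show ?thesis by blast
    qed
    from ex_rainbow_clique_subdivision[OF Bv this]
    obtain H :: "'a pair_pre_digraph" where H: "pverts H \<subseteq> A" "parcs H \<subseteq> E"
      "is_clique_subdivision t H" "rainbow_arcs (parcs H)" by blast
    obtain K where "subdivision_pair K H" using H(3) unfolding is_clique_subdivision_def by blast
    then interpret H: pair_bidirected_digraph H by (rule bidirected_digraphI_subdivision)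
    have "subgraph (with_proj H) (with_proj G)"
      using H(1,2) A(1) by (intro subgraph_with_proj G.wf_digraph H.wf_digraph) (auto simp: E_def)
    moreover have "rainbow col H"
      unfolding rainbow_def
    proof (rule inj_onI)
      fix e f assume ef: "e \<in> uedges H" "f \<in> uedges H" "col e = col f"
      obtain a b where "e = {a, b}" "(a, b) \<in> parcs H" using ef(1) by (auto simp: uedges_def)
      moreover obtain a' b' where "f = {a', b'}" "(a', b') \<in> parcs H" using ef(2) by (auto simp: uedges_def)
      ultimately show "e = f" using H(4) ef(3) unfolding rainbow_arcs_def c_def by blast
    qed
    ultimately show "\<exists>H :: 'a pair_pre_digraph.
        subgraph (with_proj H) (with_proj G) \<and> is_clique_subdivision t H \<and> rainbow col H"
      using H(3) by blast
  qed
qed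

end
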